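(* Let $s > t \ge 10$ be coprime integers. For each positive integer $d$, there is an $N_0$ (depending on $s,t,d$) such that for all integers $N\ge N_0$ the Jensen polynomial $$J^{d,N}_{\bar{p}_{s,t}}(V)=\sum_{j=0}^{d}\binom{d}{j}\,\bar{p}_{s,t}(N+j)\,V^j$$ is hyperbolic, i.e. has only real roots.
   Context: An overpartition of $N$ is a partition of $N$ in which the first occurrence of each distinct part may be overlined. $\bar p_{s,t}(N)$ is the number of overpartitions of $N$ none of whose parts is divisible by $s$ or by $t$. *)

theory Defs
  imports
    "HOL-Analysis.Analysis"
    "HOL-Library.Multiset"
    "HOL-Computational_Algebra.Polynomial"
begin

text \<open>
  An overpartition is encoded as a pair \<open>(P, L)\<close>: the multiset \<open>P\<close> holds the (positive) parts, and
  \<open>L\<close> is the set of those part sizes whose first occurrence is overlined. Only one occurrence of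
  each distinct part can be overlined, so \<open>L\<close> is an arbitrary subset of the set of distinct parts.
\<close>

definition overpartitions :: "nat \<Rightarrow> (nat multiset \<times> nat set) set" where
  "overpartitions N = {(P, L). (\<forall>x\<in>#P. 0 < x) \<and> sum_mset P = N \<and> L \<subseteq> set_mset P}"

definition biregular_overpartitions ::
    "nat \<Rightarrow> nat \<Rightarrow> nat \<Rightarrow> (nat multiset \<times> nat set) set" where
  "biregular_overpartitions s t N =
     {(P, L) \<in> overpartitions N. \<forall>x\<in>#P. \<not> s dvd x \<and> \<not> t dvd x}"

definition pbar :: "nat \<Rightarrow> nat \<Rightarrow> nat \<Rightarrow> nat" where
  "pbar s t N = card (biregular_overpartitions s t N)"

text \<open>These sets are finite, so the cardinality above is a genuine count.\<close>

lemma size_le_sum_mset: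
  fixes P :: "nat multiset"
  assumes "\<forall>x\<in>#P. 0 < x"
  shows "size P \<le> sum_mset P"
  using assms by (induction P) auto

lemma finite_overpartitions: "finite (overpartitions N)"
proof -
  let ?lists = "{xs. set xs \<subseteq> {0..N} \<and> length xs \<le> N}"
  have "overpartitions N \<subseteq> (mset ` ?lists) \<times> Pow {0..N}"
  proof (clarsimp simp: overpartitions_def)
    fix P :: "nat multiset" and L
    assume *: "\<forall>x\<in>#P. 0 < x" "L \<subseteq> set_mset P" "N = sum_mset P"
    obtain xs where xs: "mset xs = P" using ex_mset by blast
    have le: "x \<le> sum_mset P" if "x \<in># P" for x
      using that by (auto dest: multi_member_split)
    have "set xs \<subseteq> {0..sum_mset P} \<and> length xs \<le> sum_mset P"
      using le size_le_sum_mset[OF *(1)] xs by auto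
    then have "P \<in> mset ` {xs. set xs \<subseteq> {0..sum_mset P} \<and> length xs \<le> sum_mset P}"
      using xs by blast
    moreover have "L \<subseteq> {0..sum_mset P}" using *(2) le by auto
    ultimately show "P \<in> mset ` {xs. set xs \<subseteq> {0..sum_mset P} \<and> length xs \<le> sum_mset P} \<and>
        L \<subseteq> {0..sum_mset P}" by blast
  qed
  moreover have "finite ?lists" by (rule finite_lists_length_le) simp
  ultimately show ?thesis by (meson finite_Pow_iff finite_SigmaI finite_atLeastAtMost
        finite_imageI finite_subset)
qed

lemma finite_biregular_overpartitions: "finite (biregular_overpartitions s t N)"
  by (rule finite_subset[OF _ finite_overpartitions[of N]]) (auto simp: biregular_overpartitions_def)

definition jensen_poly :: "(nat \<Rightarrow> real) \<Rightarrow> nat \<Rightarrow> nat \<Rightarrow> real poly" where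
  "jensen_poly a d n = (\<Sum>j=0..d. monom (real (d choose j) * a (n + j)) j)"

definition hyperbolic :: "real poly \<Rightarrow> bool" where
  "hyperbolic p \<longleftrightarrow> (\<forall>z::complex. poly (map_poly complex_of_real p) z = 0 \<longrightarrow> z \<in> \<real>)"

end

theory Submission
  imports Defs "HOL-Probability.Probability" "HOL-Real_Asymp.Real_Asymp"
begin

text \<open>
  Let \<open>p(n)\<close> count the overpartitions of \<open>n\<close> without parts divisible by \<open>s\<close> or \<open>t\<close>, and let
  \<open>F(q) = \<Sum> p(n) q^n\<close>. The proof is a saddle point argument applied to the whole Jensen polynomial at once.
  By Cauchy's formula \<open>p(N + j)\<close> is the integral over \<open>\<theta>\<close> of \<open>F(r cis \<theta>) (r cis \<theta>)^(-N-j) / (2 pi)\<close>, so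
  the binomial sum collapses:

    \<open>J(r W) = r^(-N) / (2 pi) * \<integral> F(r cis \<theta>) cis(- N \<theta>) (1 + W cis(- \<theta>))^d d\<theta>\<close>.

  Take \<open>r = exp(-A)\<close> to be the saddle point of \<open>F(q) q^(-N)\<close>, let \<open>\<sigma>\<^sup>2\<close> be the second derivative of
  \<open>log F(exp(-A))\<close> in \<open>A\<close>, and substitute \<open>\<theta> = u / \<sigma>\<close> and \<open>W = X / \<sigma> - 1\<close>. Around the saddle
  \<open>F(r cis \<theta>) cis(- N \<theta>) / F(r)\<close> tends to \<open>exp(- u\<^sup>2 / 2)\<close>, and \<open>\<sigma> (1 + W cis(- \<theta>))\<close> tends to \<open>X + i u\<close>. So,
  up to a positive factor, \<open>J(r (X / \<sigma> - 1))\<close> tends to the integral of \<open>exp(- u\<^sup>2 / 2) (X + i u)^d\<close>, which is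
  \<open>sqrt (2 pi)\<close> times the Hermite polynomial \<open>H\<^sub>d(X)\<close> (lemma \<open>gauss_pow_integral\<close>). Since \<open>H\<^sub>d\<close> takes alternating
  signs at \<open>d + 1\<close> real points (lemma \<open>hermite_alternates\<close>), so does \<open>J\<close> for large \<open>N\<close>, and a polynomial of
  degree at most \<open>d\<close> with this property has only real zeros (lemma \<open>hyperbolic_if_sign_changes\<close>).

  The estimates for \<open>F\<close> rest on the representation \<open>F = exp(\<Sum> c\<^sub>m q^m)\<close> with \<open>c\<^sub>m \<ge> 0\<close>
  (lemma \<open>overpartitions_gf_exp\<close>). The moments
  \<open>\<Sum> c\<^sub>m m^j exp(-A m)\<close> have order \<open>A^(-j-1)\<close>: from above for \<open>j = 2, 3\<close> by summing over divisors
  (lemma \<open>parts_log_coeff_moment_le\<close>), from below for \<open>j = 1, 2\<close> because \<open>c\<^sub>m \<ge> 2\<close> for \<open>m\<close> congruent to \<open>1\<close> modulo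
  \<open>s t\<close>. Hence \<open>\<sigma>\<close> has order \<open>A^(-3/2)\<close>, and the cubic Taylor error tends to zero. Finally
  \<open>\<bar>F(r cis \<theta>)\<bar> / F(r) = exp(- \<Sum> c\<^sub>m r^m (1 - cos(m \<theta>)))\<close>, and the same progression of \<open>m\<close> bounds the
  exponent on all arcs (lemma \<open>deficit_bound\<close>). This yields an integrable majorant of the form
  \<open>(\<bar>u\<bar> + \<bar>X\<bar>)^d exp(- \<gamma> sqrt \<bar>u\<bar>)\<close>, so that a single application of dominated convergence gives the limit.
\<close>

section \<open>Hyperbolicity from sign changes\<close>

lemma of_real_poly:
  "poly (map_poly of_real p) (of_real x) = (of_real (poly p x) :: complex)"
  by (induction p) (auto simp: map_poly_pCons)

text \<open>
  A polynomial of degree at most \<open>d\<close> whose values alternate in sign at \<open>d + 1\<close> points has a real zero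
  in each of the \<open>d\<close> gaps, which leaves no room for a further complex zero. The factor \<open>e\<close> only
  fixes which of the two alternating patterns occurs. Since the condition is open and concerns finitely
  many values, it passes from a pointwise limit to the polynomials that approximate it.
\<close>

lemma hyperbolic_if_sign_changes:
  fixes p :: "real poly" and x :: "nat \<Rightarrow> real"
  assumes deg: "degree p \<le> d"
    and incr: "\<And>i j. i < j \<Longrightarrow> j \<le> d \<Longrightarrow> x i < x j"
    and sign: "\<And>i. i \<le> d \<Longrightarrow> (-1) ^ i * poly p (x i) * e > 0"
  shows "hyperbolic p"
proof -
  have pnz: "p \<noteq> 0"
    using sign[of 0] by auto
  have "\<exists>y. x i < y \<and> y < x (Suc i) \<and> poly p y = 0" if "i < d" for i
  proof -
    have "(-1::real) ^ i = 1 \<or> (-1::real) ^ i = -1"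
      by (cases "even i") auto
    then have "poly p (x i) * poly p (x (Suc i)) < 0"
      using sign[of i] sign[of "Suc i"] that by (auto simp: zero_less_mult_iff mult_less_0_iff)
    then show ?thesis
      using poly_IVT[of "x i" "x (Suc i)" p] incr[of i "Suc i"] that by auto
  qed
  then obtain y where y: "\<And>i. i < d \<Longrightarrow> x i < y i \<and> y i < x (Suc i) \<and> poly p (y i) = 0"
    by metis
  have ymono: "y i < y j" if "i < j" "j < d" for i j
  proof -
    have "y i < x (Suc i)" using y[of i] that by auto
    also have "x (Suc i) \<le> x j"
      using incr[of "Suc i" j] that by (cases "Suc i = j") auto
    also have "x j < y j" using y[of j] that by auto
    finally show ?thesis .
  qed
  have inj: "inj_on y {..<d}"
    by (rule inj_onI) (metis lessThan_iff less_irrefl linorder_neqE_nat ymono)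
  let ?q = "map_poly complex_of_real p"
  have qnz: "?q \<noteq> 0" using pnz by (simp add: map_poly_eq_0_iff)
  have degq: "degree ?q = degree p" by (simp add: degree_map_poly)
  have root: "poly ?q (of_real (y i)) = 0" if "i < d" for i
    using y[OF that] by (simp add: of_real_poly)
  show ?thesis unfolding hyperbolic_def
  proof (intro allI impI, rule ccontr)
    fix z :: complex
    assume z: "poly ?q z = 0" "z \<notin> \<real>"
    have "insert z ((\<lambda>i. of_real (y i)) ` {..<d}) \<subseteq> {z. poly ?q z = 0}"
      using z root by auto
    then have "card (insert z ((\<lambda>i. complex_of_real (y i)) ` {..<d})) \<le> card {z. poly ?q z = 0}"
      by (intro card_mono) (auto simp: poly_roots_finite qnz)
    also have "\<dots> \<le> degree ?q"
      by (rule card_poly_roots_bound[OF qnz])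
    also have "card (insert z ((\<lambda>i. complex_of_real (y i)) ` {..<d})) = Suc d"
    proof (subst card_insert_disjoint)
      show "z \<notin> (\<lambda>i. complex_of_real (y i)) ` {..<d}" using z(2) by auto
      have "inj_on (\<lambda>i. complex_of_real (y i)) {..<d}"
        using inj by (auto simp: inj_on_def)
      then show "Suc (card ((\<lambda>i. complex_of_real (y i)) ` {..<d})) = Suc d"
        by (simp add: card_image)
    qed auto
    finally show False using deg degq by simp
  qed
qed

section \<open>Hermite polynomials and their sign changes\<close>

text \<open>
  The probabilists' Hermite polynomials. The recursion says that
  \<open>H\<^sub>n\<^sub>+\<^sub>1(x) exp(-x\<^sup>2/2) = - (d/dx) (H\<^sub>n(x) exp(-x\<^sup>2/2))\<close>, which is the form used for counting sign changes.
\<close>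

fun hermite :: "nat \<Rightarrow> real poly" where
  "hermite 0 = 1"
| "hermite (Suc n) = [:0, 1:] * hermite n - pderiv (hermite n)"

lemma pderiv_hermite: "pderiv (hermite (Suc n)) = of_nat (Suc n) * hermite n"
proof (induction n)
  case 0
  show ?case by (simp add: pderiv_pCons)
next
  case (Suc n)
  have "pderiv (hermite (Suc (Suc n)))
      = hermite (Suc n) + [:0, 1:] * pderiv (hermite (Suc n)) - pderiv (pderiv (hermite (Suc n)))"
    by (subst hermite.simps(2)) (simp only: pderiv_diff pderiv_mult, simp add: pderiv_pCons algebra_simps)
  also have "\<dots> = hermite (Suc n) + of_nat (Suc n) * ([:0, 1:] * hermite n - pderiv (hermite n))"
    by (simp only: Suc.IH pderiv_mult pderiv_of_nat) (simp add: algebra_simps)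
  also have "\<dots> = of_nat (Suc (Suc n)) * hermite (Suc n)"
    by (simp only: hermite.simps(2)[symmetric]) (simp add: algebra_simps)
  finally show ?case .
qed

lemma hermite_recurrence:
  "poly (hermite (Suc (Suc n))) x = x * poly (hermite (Suc n)) x - real (Suc n) * poly (hermite n) x"
  by (subst hermite.simps(2), subst pderiv_hermite) simp

definition hermite_function :: "nat \<Rightarrow> real \<Rightarrow> real" where
  "hermite_function n x = poly (hermite n) x * exp (- x\<^sup>2 / 2)"

lemma hermite_function_deriv:
  "(hermite_function n has_real_derivative - hermite_function (Suc n) x) (at x)"
  unfolding hermite_function_def
  by (auto intro!: derivative_eq_intros simp: algebra_simps power2_eq_square)

lemma poly_times_gaussian_tendsto_0:
  fixes p :: "real poly"
  shows "((\<lambda>x. poly p x * exp (- x\<^sup>2 / 2)) \<longlongrightarrow> 0) at_top"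
proof -
  have "((\<lambda>x. \<Sum>i\<le>degree p. coeff p i * (x ^ i * exp (- x\<^sup>2 / 2))) \<longlongrightarrow> (\<Sum>i\<le>degree p. coeff p i * 0)) at_top"
    by (intro tendsto_sum tendsto_mult tendsto_const) real_asymp
  then show ?thesis by (simp add: poly_altdef sum_distrib_right mult.assoc)
qed

lemma poly_times_gaussian_tendsto_0_at_bot:
  fixes p :: "real poly"
  shows "((\<lambda>x. poly p x * exp (- x\<^sup>2 / 2)) \<longlongrightarrow> 0) at_bot"
  using poly_times_gaussian_tendsto_0[of "pcompose p [:0, -1:]"]
  by (simp add: filterlim_at_bot_mirror poly_pcompose)

text \<open>
  Rolle's theorem in terms of signs. If \<open>H\<^sub>d(x) exp(-x\<^sup>2/2)\<close> alternates at \<open>d + 1\<close> points, then, since it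
  vanishes at both infinities, its increments over \<open>d + 2\<close> consecutive intervals alternate as well. By the
  mean value theorem so does its derivative at some point of each interval, and the derivative is
  \<open>- H\<^sub>d\<^sub>+\<^sub>1(x) exp(-x\<^sup>2/2)\<close>.
\<close>

lemma hermite_alternates:
  "\<exists>x::nat \<Rightarrow> real. (\<forall>i j. i < j \<longrightarrow> j \<le> d \<longrightarrow> x i < x j) \<and>
     (\<forall>i\<le>d. (-1) ^ i * poly (hermite d) (x i) * (-1) ^ d > 0)"
proof (induction d)
  case 0
  show ?case by (intro exI[of _ "\<lambda>_. 0"]) auto
next
  case (Suc d)
  let ?f = "hermite_function d"
  obtain x :: "nat \<Rightarrow> real" where incr: "\<And>i j. i < j \<Longrightarrow> j \<le> d \<Longrightarrow> x i < x j"
    and sg: "\<And>i. i \<le> d \<Longrightarrow> (-1) ^ i * poly (hermite d) (x i) * (-1) ^ d > 0"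
    using Suc.IH by blast
  have sgf: "(-1) ^ i * ?f (x i) * (-1) ^ d > 0" if "i \<le> d" for i
    using mult_pos_pos[OF sg[OF that], of "exp (- (x i)\<^sup>2 / 2)"]
    by (simp add: hermite_function_def mult_ac)
  have "\<forall>\<^sub>F l in at_bot. \<bar>?f l\<bar> < \<bar>?f (x 0)\<bar>"
    using order_tendstoD(2)[OF tendsto_rabs[OF poly_times_gaussian_tendsto_0_at_bot[of "hermite d"]],
        of "\<bar>?f (x 0)\<bar>"] sgf[of 0] by (fastforce simp: hermite_function_def)
  then have "\<forall>\<^sub>F l in at_bot. \<bar>?f l\<bar> < \<bar>?f (x 0)\<bar> \<and> l < x 0"
    using eventually_gt_at_bot by (rule eventually_conj)
  then obtain l where l: "\<bar>?f l\<bar> < \<bar>?f (x 0)\<bar>" "l < x 0"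
    using eventually_happens'[OF trivial_limit_at_bot_linorder] by blast
  have "\<forall>\<^sub>F u in at_top. \<bar>?f u\<bar> < \<bar>?f (x d)\<bar>"
    using order_tendstoD(2)[OF tendsto_rabs[OF poly_times_gaussian_tendsto_0[of "hermite d"]],
        of "\<bar>?f (x d)\<bar>"] sgf[of d] by (fastforce simp: hermite_function_def)
  then have "\<forall>\<^sub>F u in at_top. \<bar>?f u\<bar> < \<bar>?f (x d)\<bar> \<and> u > x d"
    using eventually_gt_at_top by (rule eventually_conj)
  then obtain u where u: "\<bar>?f u\<bar> < \<bar>?f (x d)\<bar>" "x d < u"
    using eventually_happens'[OF trivial_limit_at_top_linorder] by blast
  \<comment> \<open>The old points, flanked by two points so far out that the function is
    smaller there than at its neighbours.\<close>
  define y where "y i = (if i = 0 then l else if i \<le> Suc d then x (i - 1) else u)" for i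
  have ymono: "y i < y (Suc i)" if "i \<le> Suc d" for i
    using that l u incr[of "i-1" i] by (cases i) (auto simp: y_def le_Suc_eq)
  have ysg: "(-1) ^ i * (?f (y (Suc i)) - ?f (y i)) * (-1) ^ d > 0" if i: "i \<le> Suc d" for i
  proof -
    consider "i = 0" | "0 < i" "i \<le> d" | "i = Suc d" using i by linarith
    then show ?thesis
    proof cases
      case 1
      have "(-1) ^ d * ?f (x 0) > 0" using sgf[of 0] by (simp add: mult.commute)
      moreover have "(-1::real) ^ d = 1 \<or> (-1::real) ^ d = -1"
        by (cases "even d") auto
      ultimately show ?thesis using 1 l by (auto simp: y_def)
    next
      case 2
      have "(-1) ^ i * ?f (x i) * (-1) ^ d > 0" "(-1) ^ (i-1) * ?f (x (i-1)) * (-1) ^ d > 0"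
        using sgf[of i] sgf[of "i-1"] 2 by auto
      then show ?thesis using 2 by (cases i) (auto simp: y_def algebra_simps)
    next
      case 3
      have "?f (x d) > 0" using sgf[of d] by (simp add: mult_ac flip: power_mult_distrib mult.assoc)
      moreover have "(-1::real) ^ d = 1 \<or> (-1::real) ^ d = -1"
        by (cases "even d") auto
      ultimately show ?thesis using 3 u by (auto simp: y_def)
    qed
  qed
  have "\<exists>z. y i < z \<and> z < y (Suc i) \<and> ?f (y (Suc i)) - ?f (y i) = (y (Suc i) - y i) * (- hermite_function (Suc d) z)"
    if "i \<le> Suc d" for i
    using MVT2[OF ymono[OF that], of ?f "\<lambda>z. - hermite_function (Suc d) z"] hermite_function_deriv by blast
  then obtain z where z: "\<And>i. i \<le> Suc d \<Longrightarrow> y i < z i \<and> z i < y (Suc i) \<and>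
      ?f (y (Suc i)) - ?f (y i) = (y (Suc i) - y i) * (- hermite_function (Suc d) (z i))"
    by metis
  have ymono': "y i \<le> y j" if "i \<le> j" "j \<le> Suc (Suc d)" for i j
    using that
  proof (induction j)
    case (Suc j)
    then show ?case using ymono[of j] by (cases "i = Suc j") (auto simp: le_Suc_eq)
  qed auto
  have zmono: "z i < z j" if "i < j" "j \<le> Suc d" for i j
  proof -
    have "z i < y (Suc i)" using z[of i] that by auto
    also have "\<dots> \<le> y j" using ymono'[of "Suc i" j] that by auto
    also have "\<dots> < z j" using z[of j] that by auto
    finally show ?thesis .
  qed
  have pos: "b > 0" if "0 < a * b" "0 < a" for a b :: real
    using that by (simp add: zero_less_mult_iff)
  have "(-1) ^ i * poly (hermite (Suc d)) (z i) * (-1) ^ Suc d > 0" if i: "i \<le> Suc d" for i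
  proof -
    have "(-1) ^ i * ((y (Suc i) - y i) * (- hermite_function (Suc d) (z i))) * (-1) ^ d > 0"
      using ysg[OF i] z[OF i] by simp
    also have "(-1) ^ i * ((y (Suc i) - y i) * (- hermite_function (Suc d) (z i))) * (-1) ^ d
       = ((y (Suc i) - y i) * exp (- (z i)\<^sup>2 / 2)) * ((-1) ^ i * poly (hermite (Suc d)) (z i) * (-1) ^ Suc d)"
      by (simp add: hermite_function_def algebra_simps del: hermite.simps)
    finally show ?thesis
      by (rule pos) (use ymono[OF i] in simp)
  qed
  then show ?case using zmono by (intro exI[of _ z]) blast
qed

section \<open>The Gaussian integral of a shifted power\<close>

definition gauss_pow :: "real \<Rightarrow> nat \<Rightarrow> real \<Rightarrow> complex" where
  "gauss_pow X d u = of_real (exp (- u\<^sup>2 / 2)) * (of_real X + \<i> * of_real u) ^ d"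

lemma gauss_pow_expand:
  "gauss_pow X d u = (\<Sum>k\<le>d. (of_nat (d choose k) * \<i> ^ k * of_real (X ^ (d - k))) * of_real (u ^ k * exp (- u\<^sup>2 / 2)))"
proof -
  have "(of_real X + \<i> * of_real u) ^ d = (\<Sum>k\<le>d. of_nat (d choose k) * (\<i> * complex_of_real u) ^ k * of_real X ^ (d - k))"
    by (subst add.commute) (rule binomial_ring)
  then show ?thesis unfolding gauss_pow_def
    by (simp add: sum_distrib_left power_mult_distrib mult_ac)
qed

lemma integrable_pow_gaussian: "integrable lborel (\<lambda>u::real. u ^ k * exp (- u\<^sup>2 / 2))"
proof -
  have "integrable lborel (\<lambda>x. sqrt (2 * pi) * (std_normal_density x * x ^ k))"
    by (intro integrable_mult_right integrable_std_normal_moment)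
  then show ?thesis by (simp add: std_normal_density_def field_simps)
qed

lemma integrable_gauss_pow: "integrable lborel (gauss_pow X d)"
  unfolding gauss_pow_expand[abs_def]
  by (intro Bochner_Integration.integrable_sum integrable_mult_right integrable_of_real integrable_pow_gaussian)

lemma gauss_pow_tendsto_0:
  "(gauss_pow X d \<longlongrightarrow> 0) at_top" "(gauss_pow X d \<longlongrightarrow> 0) at_bot"
proof -
  have top: "((\<lambda>u::real. u ^ k * exp (- u\<^sup>2 / 2)) \<longlongrightarrow> 0) at_top" for k
    by real_asymp
  have bot: "((\<lambda>u::real. u ^ k * exp (- u\<^sup>2 / 2)) \<longlongrightarrow> 0) at_bot" for k
    using poly_times_gaussian_tendsto_0_at_bot[of "monom 1 k"] by (simp add: poly_monom)
  have "(gauss_pow X d \<longlongrightarrow> (\<Sum>k\<le>d. (of_nat (d choose k) * \<i> ^ k * of_real (X ^ (d - k))) * of_real 0)) at_top"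
    unfolding gauss_pow_expand[abs_def] by (intro tendsto_intros top)
  then show "(gauss_pow X d \<longlongrightarrow> 0) at_top" by simp
  have "(gauss_pow X d \<longlongrightarrow> (\<Sum>k\<le>d. (of_nat (d choose k) * \<i> ^ k * of_real (X ^ (d - k))) * of_real 0)) at_bot"
    unfolding gauss_pow_expand[abs_def] by (intro tendsto_intros bot)
  then show "(gauss_pow X d \<longlongrightarrow> 0) at_bot" by simp
qed

lemma integrable_id_gauss_pow: "integrable lborel (\<lambda>u. of_real u * gauss_pow X d u)"
proof -
  have "of_real u * gauss_pow X d u = - \<i> * gauss_pow X (Suc d) u + \<i> * of_real X * gauss_pow X d u" for u
    by (simp add: gauss_pow_def algebra_simps)
  then show ?thesis
    by (simp only:) (intro Bochner_Integration.integrable_add integrable_mult_right integrable_gauss_pow)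
qed

text \<open>
  The integral over the line of the derivative of \<open>(X + i u)^d exp(-u\<^sup>2/2)\<close> vanishes. The predecessor
  \<open>d - 1\<close> is harmless at \<open>d = 0\<close>, where the factor \<open>d\<close> makes the right-hand side zero.
\<close>

lemma gauss_pow_by_parts:
  "(LBINT u. of_real u * gauss_pow X d u) = \<i> * of_nat d * (LBINT u. gauss_pow X (d - 1) u)"
proof -
  let ?f = "\<lambda>u. \<i> * of_nat d * gauss_pow X (d - 1) u - of_real u * gauss_pow X d u"
  have int: "integrable lborel ?f"
    by (intro Bochner_Integration.integrable_diff integrable_mult_right integrable_gauss_pow integrable_id_gauss_pow)
  have "(LBINT u=-\<infinity>..\<infinity>. ?f u) = 0 - 0"
  proof (rule interval_integral_FTC_integrable)
    fix u :: real
    have "((\<lambda>z. exp (- z\<^sup>2 / 2) * (of_real X + \<i> * z) ^ d) has_field_derivative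
        \<i> * of_nat d * (exp (- (of_real u)\<^sup>2 / 2) * (of_real X + \<i> * of_real u) ^ (d - 1))
        - of_real u * (exp (- (of_real u)\<^sup>2 / 2) * (of_real X + \<i> * of_real u) ^ d)) (at (complex_of_real u))"
      by (auto intro!: derivative_eq_intros simp: algebra_simps)
    from has_vector_derivative_real_field[OF this]
    have "((\<lambda>u. exp (- (complex_of_real u)\<^sup>2 / 2) * (of_real X + \<i> * of_real u) ^ d) has_vector_derivative
        \<i> * of_nat d * (exp (- (of_real u)\<^sup>2 / 2) * (of_real X + \<i> * of_real u) ^ (d - 1))
        - of_real u * (exp (- (of_real u)\<^sup>2 / 2) * (of_real X + \<i> * of_real u) ^ d)) (at u)" .
    moreover have "exp (- (complex_of_real v)\<^sup>2 / 2) = of_real (exp (- v\<^sup>2 / 2))" for v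
      by (simp flip: exp_of_real)
    ultimately show "(gauss_pow X d has_vector_derivative ?f u) (at u)"
      unfolding gauss_pow_def[abs_def] by simp
    show "isCont ?f u"
      unfolding gauss_pow_def[abs_def] by (intro continuous_intros) auto
  next
    show "set_integrable lborel (einterval (-\<infinity>) \<infinity>) ?f"
      using int by (simp add: set_integrable_def)
    show "((gauss_pow X d \<circ> real_of_ereal) \<longlongrightarrow> 0) (at_right (-\<infinity>))"
      using gauss_pow_tendsto_0(2)[of X d] by (simp add: ereal_tendsto_simps)
    show "((gauss_pow X d \<circ> real_of_ereal) \<longlongrightarrow> 0) (at_left \<infinity>)"
      using gauss_pow_tendsto_0(1)[of X d] by (simp add: ereal_tendsto_simps)
  qed auto
  then have "(LBINT u. ?f u) = 0"
    by (simp add: interval_lebesgue_integral_def set_lebesgue_integral_def)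
  also have "(LBINT u. ?f u) = \<i> * of_nat d * (LBINT u. gauss_pow X (d - 1) u) - (LBINT u. of_real u * gauss_pow X d u)"
    by (simp add: integrable_gauss_pow integrable_id_gauss_pow)
  finally show ?thesis by simp
qed

lemma gauss_pow_integral_Suc:
  "(LBINT u. gauss_pow X (Suc d) u)
     = of_real X * (LBINT u. gauss_pow X d u) - of_nat d * (LBINT u. gauss_pow X (d - 1) u)"
proof -
  have "(LBINT u. gauss_pow X (Suc d) u) = (LBINT u. of_real X * gauss_pow X d u + \<i> * (of_real u * gauss_pow X d u))"
    by (intro Bochner_Integration.integral_cong) (auto simp: gauss_pow_def algebra_simps)
  also have "\<dots> = of_real X * (LBINT u. gauss_pow X d u) + \<i> * (LBINT u. of_real u * gauss_pow X d u)"
    by (simp add: integrable_gauss_pow integrable_id_gauss_pow)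
  finally show ?thesis by (simp add: gauss_pow_by_parts algebra_simps)
qed

text \<open>
  Both sides satisfy the three-term recurrence \<open>h\<^sub>d\<^sub>+\<^sub>2 = X h\<^sub>d\<^sub>+\<^sub>1 - (d + 1) h\<^sub>d\<close>: on the left it is
  integration by parts, on the right \<open>H\<^sub>n' = n H\<^sub>n\<^sub>-\<^sub>1\<close>.
\<close>

lemma gauss_pow_integral:
  "(LBINT u. gauss_pow X d u) = of_real (sqrt (2 * pi) * poly (hermite d) X)"
proof -
  have base: "(LBINT u. gauss_pow X 0 u) = of_real (sqrt (2 * pi))"
  proof -
    have "(LBINT u. gauss_pow X 0 u) = (LBINT u. of_real (sqrt (2 * pi) * (std_normal_density u * u ^ (2 * 0))))"
      by (intro Bochner_Integration.integral_cong)
         (auto simp: gauss_pow_def std_normal_density_def)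
    also have "\<dots> = of_real (sqrt (2 * pi) * (LBINT u. std_normal_density u * u ^ (2 * 0)))"
      by (subst integral_complex_of_real, subst Bochner_Integration.integral_mult_right_zero) simp
    also have "\<dots> = of_real (sqrt (2 * pi))"
      by (subst integral_std_normal_moment_even) simp
    finally show ?thesis .
  qed
  show ?thesis
  proof (induction d rule: induct_nat_012)
    case 0
    show ?case using base by simp
  next
    case 1
    show ?case using gauss_pow_integral_Suc[of X 0] base by (simp add: pderiv_pCons)
  next
    case (ge2 d)
    have "(LBINT u. gauss_pow X (Suc (Suc d)) u)
      = of_real X * of_real (sqrt (2 * pi) * poly (hermite (Suc d)) X)
        - of_nat (Suc d) * of_real (sqrt (2 * pi) * poly (hermite d) X)"
      by (subst gauss_pow_integral_Suc) (simp only: ge2 diff_Suc_1)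
    also have "\<dots> = of_real (X * (sqrt (2 * pi) * poly (hermite (Suc d)) X)
        - real (Suc d) * (sqrt (2 * pi) * poly (hermite d) X))"
      by (simp only: of_real_diff of_real_mult of_real_of_nat_eq)
    also have "\<dots> = of_real (sqrt (2 * pi) * poly (hermite (Suc (Suc d))) X)"
      by (subst hermite_recurrence) (simp only: algebra_simps)
    finally show ?case .
  qed
qed

section \<open>Jensen polynomials as Fourier integrals\<close>

lemma integral_cis_multiple:
  fixes m :: int
  shows "has_bochner_integral lborel (\<lambda>\<theta>. indicator {-pi..pi} \<theta> *\<^sub>R cis (of_int m * \<theta>)) (if m = 0 then of_real (2 * pi) else 0)"
proof (cases "m = 0")
  case True
  have "has_bochner_integral lborel (\<lambda>\<theta>. indicator {-pi..pi} \<theta> *\<^sub>R (1::complex)) (measure lborel {-pi..pi} *\<^sub>R 1)"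
    by (rule has_bochner_integral_indicator) auto
  then show ?thesis using True by (simp add: scaleR_conv_of_real)
next
  case False
  let ?F = "\<lambda>\<theta>. cis (of_int m * \<theta>) / (\<i> * of_int m)"
  have "has_bochner_integral lborel (\<lambda>\<theta>. indicator {-pi..pi} \<theta> *\<^sub>R cis (of_int m * \<theta>)) (?F pi - ?F (-pi))"
  proof (rule has_bochner_integral_FTC_Icc)
    fix x :: real
    have "((\<lambda>\<theta>. exp (\<i> * of_int m * \<theta>) / (\<i> * of_int m)) has_field_derivative exp (\<i> * of_int m * of_real x)) (at (of_real x))"
      using False by (auto intro!: derivative_eq_intros)
    from has_vector_derivative_real_field[OF this]
    have "(?F has_vector_derivative cis (of_int m * x)) (at x)"
      by (simp add: cis_conv_exp mult.assoc)
    then show "(?F has_vector_derivative cis (of_int m * x)) (at x within {-pi..pi})"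
      by (rule has_vector_derivative_at_within)
  qed (auto intro!: continuous_intros)
  moreover have "cis (of_int m * pi) = cis (of_int m * (- pi))"
    by (simp add: complex_eq_iff sin_times_pi_eq_0)
  ultimately show ?thesis using False by simp
qed

lemma fourier_coefficient:
  fixes a :: "nat \<Rightarrow> real"
  assumes r: "r \<ge> 0" and sm: "summable (\<lambda>n. \<bar>a n\<bar> * r ^ n)"
  shows "has_bochner_integral lborel
    (\<lambda>\<theta>. indicator {-pi..pi} \<theta> *\<^sub>R ((\<Sum>n. of_real (a n) * (of_real r * cis \<theta>) ^ n) * cis (- (real k * \<theta>))))
    (of_real (2 * pi * a k * r ^ k))"
proof -
  define f where "f n \<theta> = indicator {-pi..pi} \<theta> *\<^sub>R (of_real (a n) * (of_real r * cis \<theta>) ^ n * cis (- (real k * \<theta>)))"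
    for n and \<theta> :: real
  have f_eq: "f n \<theta> = of_real (a n * r ^ n) * (indicator {-pi..pi} \<theta> *\<^sub>R cis (of_int (int n - int k) * \<theta>))" for n \<theta>
    by (simp add: f_def power_mult_distrib Complex.DeMoivre cis_mult algebra_simps)
  have f_int: "has_bochner_integral lborel (f n) (of_real (a n * r ^ n) * (if int n - int k = 0 then of_real (2 * pi) else 0))" for n
    unfolding f_eq by (intro has_bochner_integral_mult_right integral_cis_multiple)
  have nf: "norm (f n \<theta>) = \<bar>a n\<bar> * r ^ n * indicator {-pi..pi} \<theta>" for n \<theta>
    using r by (simp add: f_def norm_mult norm_power indicator_def)
  have 1: "summable (\<lambda>n. norm (f n \<theta>))" for \<theta>
    unfolding nf by (intro summable_mult2 sm)
  have 2: "summable (\<lambda>n. LBINT \<theta>. norm (f n \<theta>))"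
    unfolding nf by (simp add: summable_mult2 sm)
  have int: "integrable lborel (f n)" for n
    using f_int[of n] by (simp add: has_bochner_integral_iff)
  have "(\<lambda>n. integral\<^sup>L lborel (f n)) sums (LBINT \<theta>. (\<Sum>n. f n \<theta>))"
    by (rule sums_integral) (use int 1 2 in auto)
  also have "(\<lambda>n. integral\<^sup>L lborel (f n)) = (\<lambda>n. if n = k then of_real (2 * pi * a k * r ^ k) else 0)"
    using has_bochner_integral_integral_eq[OF f_int] by (auto simp: fun_eq_iff mult_ac)
  finally have "(LBINT \<theta>. (\<Sum>n. f n \<theta>)) = of_real (2 * pi * a k * r ^ k)"
    using sums_single[of k "\<lambda>_. complex_of_real (2 * pi * a k * r ^ k)"]
    by (metis sums_unique2)
  moreover have "integrable lborel (\<lambda>\<theta>. (\<Sum>n. f n \<theta>))"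
    by (rule integrable_suminf) (use int 1 2 in auto)
  ultimately have "has_bochner_integral lborel (\<lambda>\<theta>. (\<Sum>n. f n \<theta>)) (of_real (2 * pi * a k * r ^ k))"
    by (simp add: has_bochner_integral_iff)
  also have "(\<lambda>\<theta>. (\<Sum>n. f n \<theta>)) = (\<lambda>\<theta>. indicator {-pi..pi} \<theta> *\<^sub>R ((\<Sum>n. of_real (a n) * (of_real r * cis \<theta>) ^ n) * cis (- (real k * \<theta>))))"
  proof
    fix \<theta> :: real
    have "summable (\<lambda>n. of_real (a n) * (of_real r * cis \<theta>) ^ n)"
      by (rule summable_norm_cancel) (use r sm in \<open>simp add: norm_mult norm_power\<close>)
    then show "(\<Sum>n. f n \<theta>) = indicator {-pi..pi} \<theta> *\<^sub>R ((\<Sum>n. of_real (a n) * (of_real r * cis \<theta>) ^ n) * cis (- (real k * \<theta>)))"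
      unfolding f_def by (simp add: suminf_mult2 suminf_scaleR_right summable_mult2)
  qed
  finally show ?thesis .
qed

text \<open>
  Shifting the index of a Fourier coefficient multiplies the integrand by \<open>cis (- \<theta>)\<close>, so the
  binomial sum that defines the Jensen polynomial becomes a \<open>d\<close>-th power under the integral.
\<close>

lemma jensen_poly_integral:
  fixes a :: "nat \<Rightarrow> real"
  assumes r: "r \<ge> 0" and sm: "summable (\<lambda>n. \<bar>a n\<bar> * r ^ n)"
  shows "has_bochner_integral lborel
    (\<lambda>\<theta>. indicator {-pi..pi} \<theta> *\<^sub>R ((\<Sum>n. of_real (a n) * (of_real r * cis \<theta>) ^ n) * cis (- (real N * \<theta>))
        * (1 + of_real W * cis (- \<theta>)) ^ d))
    (of_real (2 * pi * r ^ N * poly (jensen_poly a d N) (r * W)))"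
proof -
  let ?f = "\<lambda>\<theta>. (\<Sum>n. complex_of_real (a n) * (of_real r * cis \<theta>) ^ n)"
  have "has_bochner_integral lborel
     (\<lambda>\<theta>. \<Sum>j\<le>d. of_real (real (d choose j) * W ^ j) * (indicator {-pi..pi} \<theta> *\<^sub>R (?f \<theta> * cis (- (real (N + j) * \<theta>)))))
     (\<Sum>j\<le>d. of_real (real (d choose j) * W ^ j) * of_real (2 * pi * a (N + j) * r ^ (N + j)))"
    by (intro has_bochner_integral_sum has_bochner_integral_mult_right fourier_coefficient assms)
  also have "(\<lambda>\<theta>. \<Sum>j\<le>d. of_real (real (d choose j) * W ^ j) * (indicator {-pi..pi} \<theta> *\<^sub>R (?f \<theta> * cis (- (real (N + j) * \<theta>)))))
    = (\<lambda>\<theta>. indicator {-pi..pi} \<theta> *\<^sub>R (?f \<theta> * cis (- (real N * \<theta>)) * (1 + of_real W * cis (- \<theta>)) ^ d))"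
  proof
    fix \<theta> :: real
    have "(1 + of_real W * cis (- \<theta>)) ^ d = (\<Sum>j\<le>d. of_nat (d choose j) * (of_real W * cis (- \<theta>)) ^ j)"
      by (subst add.commute, subst binomial_ring) simp
    moreover have "cis (- (real (N + j) * \<theta>)) = cis (- (real N * \<theta>)) * cis (- \<theta>) ^ j" for j
      by (simp add: Complex.DeMoivre cis_mult algebra_simps)
    ultimately show "(\<Sum>j\<le>d. of_real (real (d choose j) * W ^ j) * (indicator {-pi..pi} \<theta> *\<^sub>R (?f \<theta> * cis (- (real (N + j) * \<theta>)))))
      = indicator {-pi..pi} \<theta> *\<^sub>R (?f \<theta> * cis (- (real N * \<theta>)) * (1 + of_real W * cis (- \<theta>)) ^ d)"
      by (simp add: sum_distrib_left scaleR_conv_of_real power_mult_distrib mult_ac)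
  qed
  also have "(\<Sum>j\<le>d. complex_of_real (real (d choose j) * W ^ j) * of_real (2 * pi * a (N + j) * r ^ (N + j)))
     = of_real (2 * pi * r ^ N * poly (jensen_poly a d N) (r * W))"
    by (simp add: jensen_poly_def poly_sum poly_monom sum_distrib_left power_mult_distrib power_add
         mult_ac atMost_atLeast0)
  finally show ?thesis .
qed

text \<open>
  The argument \<open>r (X / s - 1)\<close> is chosen to make the \<open>d\<close>-th power converge: with \<open>\<theta> = u / s\<close> one has
  \<open>s (1 + (X / s - 1) cis (- \<theta>)) = s (1 - cis (- \<theta>)) + X cis (- \<theta>)\<close>, which tends to \<open>X + i u\<close> as
  \<open>s\<close> grows.
\<close>

lemma jensen_poly_scaled_integral:
  fixes a :: "nat \<Rightarrow> real"
  assumes r: "r \<ge> 0" and sm: "summable (\<lambda>n. \<bar>a n\<bar> * r ^ n)" and s: "s > 0"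
  shows "(LBINT u. indicator {-(pi * s)..pi * s} u *\<^sub>R
        ((\<Sum>n. of_real (a n) * (of_real r * cis (u / s)) ^ n) * cis (- (real N * (u / s)))
         * (of_real s * (1 - cis (- (u / s))) + of_real X * cis (- (u / s))) ^ d))
    = of_real (2 * pi * r ^ N * s ^ Suc d * poly (jensen_poly a d N) (r * (X / s - 1)))"
proof -
  let ?f = "\<lambda>\<theta>. (\<Sum>n. complex_of_real (a n) * (of_real r * cis \<theta>) ^ n)"
  let ?W = "X / s - 1"
  let ?g = "\<lambda>\<theta>. indicator {-pi..pi} \<theta> *\<^sub>R (?f \<theta> * cis (- (real N * \<theta>)) * (1 + of_real ?W * cis (- \<theta>)) ^ d)"
  have fac: "of_real s * (1 - cis (- (u / s))) + of_real X * cis (- (u / s)) = of_real s * (1 + of_real ?W * cis (- (u / s)))" for u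
    using s by (simp add: field_simps)
  have "(LBINT u. indicator {-(pi * s)..pi * s} u *\<^sub>R (?f (u / s) * cis (- (real N * (u / s)))
         * (of_real s * (1 - cis (- (u / s))) + of_real X * cis (- (u / s))) ^ d))
      = (LBINT u. of_real (s ^ d) * ?g (0 + (1 / s) * u))"
  proof (rule Bochner_Integration.integral_cong[OF refl])
    fix u :: real
    have "u \<in> {-(pi * s)..pi * s} \<longleftrightarrow> u / s \<in> {-pi..pi}"
      using s by (auto simp: field_simps)
    then show "indicator {-(pi * s)..pi * s} u *\<^sub>R (?f (u / s) * cis (- (real N * (u / s)))
         * (of_real s * (1 - cis (- (u / s))) + of_real X * cis (- (u / s))) ^ d)
        = of_real (s ^ d) * ?g (0 + (1 / s) * u)"
      unfolding fac power_mult_distrib by (simp add: indicator_def)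
  qed
  also have "\<dots> = of_real (s ^ d) * (LBINT u. ?g (0 + (1 / s) * u))"
    by (rule Bochner_Integration.integral_mult_right_zero)
  also have "(LBINT u. ?g (0 + (1 / s) * u)) = s *\<^sub>R (LBINT u. ?g u)"
    by (subst (2) lborel_integral_real_affine[of "1 / s" _ 0]) (use s in auto)
  also have "(LBINT u. ?g u) = of_real (2 * pi * r ^ N * poly (jensen_poly a d N) (r * ?W))"
    by (rule has_bochner_integral_integral_eq[OF jensen_poly_integral[OF r sm]])
  finally show ?thesis by (simp add: scaleR_conv_of_real mult_ac)
qed

section \<open>Oscillation along an arithmetic progression\<close>

text \<open>
  The constant comes from \<open>cos x \<le> 1 - x\<^sup>2/2 + x^4/24\<close> together with \<open>pi\<^sup>2 \<le> 10\<close>.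
\<close>

lemma one_minus_cos_ge:
  fixes x :: real
  assumes "\<bar>x\<bar> \<le> pi"
  shows "x\<^sup>2 / 12 \<le> 1 - cos x"
proof -
  have "pi\<^sup>2 \<le> 3.1416\<^sup>2"
    using pi_approx by (intro power_mono) auto
  then have x2: "x\<^sup>2 \<le> 10"
    using power_mono[OF assms, of 2] by (simp add: power2_eq_square)
  have "cos x \<le> 1 - x\<^sup>2 / 2 + x ^ 4 / 24"
  proof -
    obtain t where "cos x = (\<Sum>m<4. cos_coeff m * x ^ m) + cos (t + 1/2 * real 4 * pi) / fact 4 * x ^ 4"
      using Maclaurin_cos_expansion[of x 4] by blast
    moreover have "cos (t + 1/2 * real 4 * pi) / fact 4 * x ^ 4 \<le> 1 / fact 4 * x ^ 4"
      by (intro mult_right_mono divide_right_mono) auto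
    moreover have "{..<4::nat} = {0, 1, 2, 3}" by auto
    then have "(\<Sum>m<4. cos_coeff m * x ^ m) = 1 - x\<^sup>2 / 2"
      by (simp add: cos_coeff_def)
    ultimately show ?thesis by (simp add: fact_numeral)
  qed
  moreover have "x ^ 4 \<le> 10 * x\<^sup>2"
    using mult_right_mono[OF x2, of "x\<^sup>2"] by (simp flip: power_add)
  ultimately show ?thesis
    using zero_le_power2[of x] by linarith
qed

lemma geometric_progression_sum:
  fixes A \<theta> :: real and M :: nat
  assumes A: "A > 0" and M: "M \<ge> 1"
  defines "\<rho> \<equiv> exp (- (real M * A))"
  shows "(\<lambda>j. exp (- A * real (M * j + 1)) * (1 - cos (real (M * j + 1) * \<theta>))) sums
    (exp (- A) * (1 / (1 - \<rho>) - Re (cis \<theta> / (1 - of_real \<rho> * cis (real M * \<theta>)))))"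
proof -
  have rho: "0 < \<rho>" "\<rho> < 1" using A M by (auto simp: \<rho>_def)
  have pw: "exp (- A * real (M * j + 1)) = exp (- A) * \<rho> ^ j" for j
    by (simp add: \<rho>_def algebra_simps flip: exp_of_nat_mult exp_add)
  have 1: "(\<lambda>j. \<rho> ^ j) sums (1 / (1 - \<rho>))"
    using geometric_sums[of \<rho>] rho by simp
  have "(\<lambda>j. (of_real \<rho> * cis (real M * \<theta>)) ^ j) sums (1 / (1 - of_real \<rho> * cis (real M * \<theta>)))"
    using geometric_sums[of "of_real \<rho> * cis (real M * \<theta>)"] rho by (simp add: norm_mult)
  from sums_Re[OF sums_mult[OF this, of "cis \<theta>"]]
  have 2: "(\<lambda>j. \<rho> ^ j * cos (real (M * j + 1) * \<theta>)) sums Re (cis \<theta> / (1 - of_real \<rho> * cis (real M * \<theta>)))"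
  proof -
    assume *: "(\<lambda>n. Re (cis \<theta> * (complex_of_real \<rho> * cis (real M * \<theta>)) ^ n)) sums
      Re (cis \<theta> * (1 / (1 - complex_of_real \<rho> * cis (real M * \<theta>))))"
    have "cis \<theta> * (complex_of_real \<rho> * cis (real M * \<theta>)) ^ j = of_real (\<rho> ^ j) * cis (real (M * j + 1) * \<theta>)" for j
      by (simp add: power_mult_distrib Complex.DeMoivre mult.left_commute[of "cis \<theta>"] cis_mult algebra_simps)
    then show ?thesis using * by simp
  qed
  show ?thesis
    unfolding pw using sums_mult[OF sums_diff[OF 1 2], of "exp (- A)"]
    by (simp only: right_diff_distrib mult.assoc mult_1_right)
qed

text \<open>
  The real part is at most \<open>1 / (1 - \<rho>)\<close>, with equality only if \<open>\<phi>\<close> and \<open>\<theta>\<close> are both multiples of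
  \<open>2 pi\<close>; this is the quantitative version. Either \<open>\<phi>\<close> is far enough from these multiples to enlarge
  the modulus of the denominator, or the denominator is close to \<open>1 - \<rho>\<close> and then the
  phase \<open>cis \<theta>\<close> in the numerator causes the loss.
\<close>

lemma Re_cis_over_le:
  fixes \<rho> \<theta> \<phi> \<eta> :: real
  assumes rho: "0 < \<rho>" "\<rho> < 1" and eta: "0 < \<eta>" "\<eta> \<le> 1/2"
    and alt: "\<eta>\<^sup>2 * (1 - \<rho>)\<^sup>2 \<le> 2 * \<rho> * (1 - cos \<phi>) \<or> cos \<theta> \<le> 1 - 3 * \<eta>"
  shows "Re (cis \<theta> / (1 - of_real \<rho> * cis \<phi>)) \<le> (1 - \<eta>\<^sup>2 / 4) / (1 - \<rho>)"
proof -
  let ?D = "1 - of_real \<rho> * cis \<phi>"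
  have D2: "(cmod ?D)\<^sup>2 = (1 - \<rho>)\<^sup>2 + 2 * \<rho> * (1 - cos \<phi>)"
  proof -
    have "(cmod ?D)\<^sup>2 = (1 - \<rho> * cos \<phi>)\<^sup>2 + (\<rho> * sin \<phi>)\<^sup>2"
      by (simp add: cmod_power2)
    also have "\<dots> = 1 - 2 * \<rho> * cos \<phi> + \<rho>\<^sup>2"
      by (simp add: power_mult_distrib sin_squared_eq power2_diff) (simp add: algebra_simps)
    finally show ?thesis by (simp add: power2_eq_square algebra_simps)
  qed
  show ?thesis
  proof (cases "\<eta>\<^sup>2 * (1 - \<rho>)\<^sup>2 \<le> 2 * \<rho> * (1 - cos \<phi>)")
    case True
    have "((1 + \<eta>\<^sup>2 / 3) * (1 - \<rho>))\<^sup>2 \<le> (cmod ?D)\<^sup>2"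
    proof -
      have "\<eta>\<^sup>2 \<le> (1/2)\<^sup>2" using eta by (intro power_mono) auto
      then have "\<eta>\<^sup>2 * \<eta>\<^sup>2 \<le> 1 * \<eta>\<^sup>2" by (intro mult_right_mono) (auto simp: power2_eq_square)
      moreover have "(1 + \<eta>\<^sup>2 / 3)\<^sup>2 = 1 + 2 * \<eta>\<^sup>2 / 3 + \<eta>\<^sup>2 * \<eta>\<^sup>2 / 9"
        by (simp add: power2_eq_square field_simps)
      ultimately have "(1 + \<eta>\<^sup>2 / 3)\<^sup>2 \<le> 1 + \<eta>\<^sup>2"
        using zero_le_power2[of \<eta>] by linarith
      then have "(1 + \<eta>\<^sup>2 / 3)\<^sup>2 * (1 - \<rho>)\<^sup>2 \<le> (1 + \<eta>\<^sup>2) * (1 - \<rho>)\<^sup>2"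
        by (intro mult_right_mono) auto
      then show ?thesis unfolding D2 power_mult_distrib using True by (simp add: distrib_right)
    qed
    then have D: "(1 + \<eta>\<^sup>2 / 3) * (1 - \<rho>) \<le> cmod ?D"
      by (rule power2_le_imp_le) simp
    have "Re (cis \<theta> / ?D) \<le> cmod (cis \<theta> / ?D)" by (rule complex_Re_le_cmod)
    also have "\<dots> = 1 / cmod ?D" by (simp add: norm_divide)
    also have "\<dots> \<le> 1 / ((1 + \<eta>\<^sup>2 / 3) * (1 - \<rho>))"
      by (rule divide_left_mono[OF D]) (use rho D in \<open>auto intro!: mult_pos_pos add_pos_nonneg intro: less_le_trans[OF mult_pos_pos D]\<close>)
    also have "\<dots> = 1 / (1 + \<eta>\<^sup>2 / 3) / (1 - \<rho>)" by simp
    also have "\<dots> \<le> (1 - \<eta>\<^sup>2 / 4) / (1 - \<rho>)"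
    proof (rule divide_right_mono)
      have "\<eta>\<^sup>2 \<le> (1/2)\<^sup>2" using eta by (intro power_mono) auto
      then have "\<eta>\<^sup>2 * \<eta>\<^sup>2 \<le> 1 * \<eta>\<^sup>2" by (intro mult_right_mono) (auto simp: power2_eq_square)
      then have "1 \<le> (1 - \<eta>\<^sup>2 / 4) * (1 + \<eta>\<^sup>2 / 3)" by (simp add: algebra_simps)
      then show "1 / (1 + \<eta>\<^sup>2 / 3) \<le> 1 - \<eta>\<^sup>2 / 4"
        by (subst pos_divide_le_eq) (auto intro: add_pos_nonneg)
    qed (use rho in auto)
    finally show ?thesis .
  next
    case False
    then have c: "cos \<theta> \<le> 1 - 3 * \<eta>" using alt by blast
    define \<zeta> where "\<zeta> = of_real \<rho> * (cis \<phi> - 1) / of_real (1 - \<rho>)"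
    have D: "?D = of_real (1 - \<rho>) * (1 - \<zeta>)"
      using rho by (simp add: \<zeta>_def field_simps)
    have "(cmod (cis \<phi> - 1))\<^sup>2 = (cos \<phi> - 1)\<^sup>2 + (sin \<phi>)\<^sup>2"
      by (simp add: cmod_power2)
    also have "\<dots> = 1 - 2 * cos \<phi> + ((cos \<phi>)\<^sup>2 + (sin \<phi>)\<^sup>2)"
      by (simp add: power2_eq_square algebra_simps)
    finally have c2: "(cmod (cis \<phi> - 1))\<^sup>2 = 2 * (1 - cos \<phi>)" by simp
    have "(\<rho> * cmod (cis \<phi> - 1))\<^sup>2 \<le> (\<eta> * (1 - \<rho>))\<^sup>2"
    proof -
      have "(\<rho> * cmod (cis \<phi> - 1))\<^sup>2 = \<rho> * (2 * \<rho> * (1 - cos \<phi>))"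
        by (simp add: power_mult_distrib c2) (simp add: power2_eq_square)
      also have "\<dots> \<le> 1 * (2 * \<rho> * (1 - cos \<phi>))"
        using rho by (intro mult_right_mono mult_nonneg_nonneg) auto
      also have "\<dots> \<le> (\<eta> * (1 - \<rho>))\<^sup>2" using False by (simp add: power_mult_distrib)
      finally show ?thesis .
    qed
    then have "\<rho> * cmod (cis \<phi> - 1) \<le> \<eta> * (1 - \<rho>)"
      by (rule power2_le_imp_le) (use eta rho in auto)
    then have z: "cmod \<zeta> \<le> \<eta>"
      using rho by (simp add: \<zeta>_def norm_mult norm_divide pos_divide_le_eq del: of_real_diff)
    then have z1: "1 - \<zeta> \<noteq> 0" using eta by auto
    have z2: "1/2 \<le> cmod (1 - \<zeta>)"
      using norm_triangle_ineq2[of 1 \<zeta>] z eta by simp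
    have "cis \<theta> / (1 - \<zeta>) = cis \<theta> + cis \<theta> * \<zeta> / (1 - \<zeta>)"
      using z1 by (simp add: field_simps)
    then have "Re (cis \<theta> / (1 - \<zeta>)) \<le> cos \<theta> + cmod (cis \<theta> * \<zeta> / (1 - \<zeta>))"
      using complex_Re_le_cmod[of "cis \<theta> * \<zeta> / (1 - \<zeta>)"] by simp
    also have "cmod (cis \<theta> * \<zeta> / (1 - \<zeta>)) \<le> \<eta> / (1/2)"
      unfolding norm_divide norm_mult using z z2 eta by (intro frac_le) auto
    also have "cos \<theta> + \<eta> / (1/2) \<le> 1 - \<eta>" using c by simp
    also have "\<eta>\<^sup>2 / 4 \<le> \<eta>" using eta mult_right_mono[of \<eta> 4 \<eta>] by (simp add: power2_eq_square)
    then have "1 - \<eta> \<le> 1 - \<eta>\<^sup>2 / 4" by simp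
    finally have "Re (cis \<theta> / (1 - \<zeta>)) \<le> 1 - \<eta>\<^sup>2 / 4" by simp
    then have "Re (cis \<theta> / (1 - \<zeta>)) / (1 - \<rho>) \<le> (1 - \<eta>\<^sup>2 / 4) / (1 - \<rho>)"
      using rho by (intro divide_right_mono) auto
    moreover have "Re (cis \<theta> / ?D) = Re (cis \<theta> / (1 - \<zeta>)) / (1 - \<rho>)"
    proof -
      have "cis \<theta> / ?D = (cis \<theta> / (1 - \<zeta>)) / of_real (1 - \<rho>)"
        unfolding D by (simp add: mult.commute)
      then show ?thesis by (simp only: Re_divide_of_real)
    qed
    ultimately show ?thesis by simp
  qed
qed

text \<open>
  This is the minor arc estimate. As soon as \<open>\<bar>\<theta>\<bar>\<close> exceeds a multiple of \<open>A\<close>, the phases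
  \<open>(M j + 1) \<theta>\<close> cannot all stay near multiples of \<open>2 pi\<close> for \<open>j\<close> up to \<open>1 / A\<close>: if their step \<open>M \<theta>\<close> does,
  then it is the start \<open>\<theta>\<close> that does not. So the sum is of its maximal order \<open>1 / A\<close>. Because the
  progression consists of the numbers congruent to \<open>1\<close>, no root of unity other than \<open>1\<close> is exceptional.
\<close>

lemma far_arc_bound:
  fixes \<epsilon> :: real and M :: nat
  assumes eps: "\<epsilon> > 0" and M: "M \<ge> 1"
  shows "\<exists>\<delta>>0. \<forall>A \<theta>. 0 < A \<longrightarrow> A \<le> 1 \<longrightarrow> \<epsilon> * A \<le> \<bar>\<theta>\<bar> \<longrightarrow> \<bar>\<theta>\<bar> \<le> pi \<longrightarrow>
     \<delta> / A \<le> (\<Sum>j. exp (- A * real (M * j + 1)) * (1 - cos (real (M * j + 1) * \<theta>)))"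
proof -
  let ?M = "real M"
  \<comment> \<open>The three entries are what \<open>Re_cis_over_le\<close> asks for, what forces \<open>M \<bar>\<theta>\<bar> \<le> 1\<close> once
    \<open>cos \<theta>\<close> is close to 1, and what then contradicts \<open>\<bar>\<theta>\<bar> \<ge> \<epsilon> A\<close>.\<close>
  define \<eta> where "\<eta> = Min {1/2, 1 / (36 * ?M\<^sup>2), \<epsilon> * exp (- ?M / 2) / 3}"
  have Mpos: "?M \<ge> 1" using M by simp
  have eta: "0 < \<eta>" "\<eta> \<le> 1/2" "\<eta> \<le> 1 / (36 * ?M\<^sup>2)" "\<eta> \<le> \<epsilon> * exp (- ?M / 2) / 3"
    using eps Mpos by (auto simp: \<eta>_def)
  define \<delta> where "\<delta> = exp (-1) * (\<eta>\<^sup>2 / 4) / ?M"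
  have "\<delta> > 0" using eta Mpos by (simp add: \<delta>_def)
  moreover have "\<delta> / A \<le> (\<Sum>j. exp (- A * real (M * j + 1)) * (1 - cos (real (M * j + 1) * \<theta>)))"
    if A: "0 < A" "A \<le> 1" and th: "\<epsilon> * A \<le> \<bar>\<theta>\<bar>" "\<bar>\<theta>\<bar> \<le> pi" for A \<theta>
  proof -
    define \<rho> where "\<rho> = exp (- (?M * A))"
    have rho: "0 < \<rho>" "\<rho> < 1" using A Mpos by (auto simp: \<rho>_def)
    have rho_lin: "1 - \<rho> \<le> ?M * A"
      using exp_ge_add_one_self[of "- (?M * A)"] by (simp add: \<rho>_def)
    \<comment> \<open>Otherwise \<open>\<theta>\<close> is so small that \<open>M \<theta>\<close> does not wrap around the circle, and
      \<open>1 - cos (M \<theta>)\<close> being tiny puts \<open>\<theta>\<close> itself inside the excluded arc.\<close>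
    have alt: "\<eta>\<^sup>2 * (1 - \<rho>)\<^sup>2 \<le> 2 * \<rho> * (1 - cos (?M * \<theta>)) \<or> cos \<theta> \<le> 1 - 3 * \<eta>"
    proof (rule ccontr)
      assume "\<not> ?thesis"
      then have 1: "2 * \<rho> * (1 - cos (?M * \<theta>)) < \<eta>\<^sup>2 * (1 - \<rho>)\<^sup>2" and 2: "1 - cos \<theta> < 3 * \<eta>" by auto
      have "\<theta>\<^sup>2 \<le> 36 * \<eta>" using one_minus_cos_ge[OF th(2)] 2 by simp
      also have "\<dots> \<le> 1 / ?M\<^sup>2" using eta(3) by simp
      finally have "(?M * \<theta>)\<^sup>2 \<le> 1\<^sup>2" using Mpos by (simp add: power_mult_distrib field_simps)
      then have "\<bar>?M * \<theta>\<bar> \<le> 1" using abs_le_square_iff[of "?M * \<theta>" 1] by simp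
      then have "\<bar>?M * \<theta>\<bar> \<le> pi" using pi_gt3 by linarith
      from one_minus_cos_ge[OF this]
      have "2 * \<rho> * ((?M * \<theta>)\<^sup>2 / 12) \<le> 2 * \<rho> * (1 - cos (?M * \<theta>))"
        using rho by (intro mult_left_mono) auto
      also have "\<dots> < \<eta>\<^sup>2 * (1 - \<rho>)\<^sup>2" by (rule 1)
      also have "\<dots> \<le> \<eta>\<^sup>2 * (?M * A)\<^sup>2"
        using rho rho_lin by (intro mult_left_mono power_mono) auto
      finally have "?M\<^sup>2 * (\<rho> * \<theta>\<^sup>2) < ?M\<^sup>2 * (6 * \<eta>\<^sup>2 * A\<^sup>2)"
        by (simp add: power_mult_distrib algebra_simps)
      then have 3: "\<rho> * \<theta>\<^sup>2 < 6 * \<eta>\<^sup>2 * A\<^sup>2" using Mpos by simp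
      have "(\<epsilon> * A)\<^sup>2 \<le> \<theta>\<^sup>2" using th(1) eps A by (simp add: abs_le_square_iff[symmetric])
      moreover have "exp (- ?M) \<le> \<rho>"
        using mult_left_mono[of A 1 ?M] A by (simp add: \<rho>_def)
      ultimately have "exp (- ?M) * (\<epsilon> * A)\<^sup>2 \<le> \<rho> * \<theta>\<^sup>2" using rho by (intro mult_mono) auto
      with 3 have "A\<^sup>2 * (exp (- ?M) * \<epsilon>\<^sup>2) < A\<^sup>2 * (6 * \<eta>\<^sup>2)"
        by (simp add: power_mult_distrib algebra_simps)
      then have 4: "exp (- ?M) * \<epsilon>\<^sup>2 < 6 * \<eta>\<^sup>2" using A by simp
      have "\<eta>\<^sup>2 \<le> (\<epsilon> * exp (- ?M / 2) / 3)\<^sup>2" using eta by (intro power_mono) auto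
      also have "\<dots> = \<epsilon>\<^sup>2 * exp (- ?M) / 9"
        by (simp add: power_mult_distrib power_divide flip: exp_double)
      finally have "6 * \<eta>\<^sup>2 \<le> (6/9) * (exp (- ?M) * \<epsilon>\<^sup>2)" by (simp add: mult.commute)
      moreover have "0 < exp (- ?M) * \<epsilon>\<^sup>2" using eps by simp
      ultimately show False using 4 by linarith
    qed
    have "\<delta> / A \<le> exp (-1) * (\<eta>\<^sup>2 / 4) / (1 - \<rho>)"
      unfolding \<delta>_def divide_divide_eq_left
      by (rule divide_left_mono[OF rho_lin]) (use A Mpos rho in auto)
    also have "\<dots> \<le> exp (- A) * (\<eta>\<^sup>2 / 4) / (1 - \<rho>)"
      using A rho by (intro divide_right_mono mult_right_mono) auto
    also have "\<dots> = exp (- A) * (1 / (1 - \<rho>) - (1 - \<eta>\<^sup>2 / 4) / (1 - \<rho>))"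
      by (simp flip: diff_divide_distrib)
    also have "\<dots> \<le> exp (- A) * (1 / (1 - \<rho>) - Re (cis \<theta> / (1 - of_real \<rho> * cis (?M * \<theta>))))"
      using Re_cis_over_le[OF rho eta(1,2) alt] by simp
    also have "\<dots> = (\<Sum>j. exp (- A * real (M * j + 1)) * (1 - cos (real (M * j + 1) * \<theta>)))"
      using sums_unique[OF geometric_progression_sum[OF A(1) M, of \<theta>]] by (simp add: \<rho>_def)
    finally show ?thesis .
  qed
  ultimately show ?thesis by blast
qed

lemma sum_squares_ge: "real (J + 1) ^ 3 / 3 \<le> (\<Sum>j\<le>J. real (j + 1) ^ 2)"
proof (induction J)
  case (Suc J)
  have "real (Suc J + 1) ^ 3 / 3 \<le> real (J + 1) ^ 3 / 3 + real (Suc J + 1) ^ 2"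
  proof -
    have "real (Suc J + 1) ^ 3 / 3 = real (J + 1) ^ 3 / 3 + (real J + 1)\<^sup>2 + (real J + 1) + 1 / 3"
      by (simp add: power3_eq_cube power2_eq_square field_simps)
    moreover have "real (Suc J + 1) ^ 2 = (real J + 1)\<^sup>2 + 2 * (real J + 1) + 1"
      by (simp add: power2_eq_square algebra_simps)
    ultimately show ?thesis by simp
  qed
  then show ?case using Suc by simp
qed auto

section \<open>Exponentials of power series with nonnegative coefficients\<close>

lemma summable_power_times_exp:
  fixes A :: real
  assumes "A > 0"
  shows "summable (\<lambda>m. real m ^ k * exp (- A * real m))"
proof (rule summable_comparison_test_bigo)
  show "summable (\<lambda>m. norm (1 / real m ^ 2))"
    using inverse_power_summable[of 2, where 'a = real] by (simp add: inverse_eq_divide)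
  show "(\<lambda>m. real m ^ k * exp (- A * real m)) \<in> O(\<lambda>m. 1 / real m ^ 2)"
    using assms by real_asymp
qed

lemma integrable_power_times_exp_sqrt:
  fixes b c :: real
  assumes c: "c > 0" and b: "b \<ge> 0"
  shows "integrable lborel (\<lambda>u. (\<bar>u\<bar> + b) ^ d * exp (- c * sqrt \<bar>u\<bar>))"
proof -
  let ?h = "\<lambda>u::real. (1 + u\<^sup>2) * ((u + b) ^ d * exp (- c * sqrt u))"
  have "(?h \<longlongrightarrow> 0) at_top"
    using c by real_asymp
  then have "\<forall>\<^sub>F u in at_top. ?h u < 1"
    by (rule order_tendstoD) simp
  then obtain U where U: "\<And>u. u \<ge> U \<Longrightarrow> ?h u < 1"
    by (auto simp: eventually_at_top_linorder)
  have "compact (?h ` {0..\<bar>U\<bar>})"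
    by (intro compact_continuous_image continuous_intros) auto
  then obtain K where K: "\<And>u. u \<in> {0..\<bar>U\<bar>} \<Longrightarrow> norm (?h u) \<le> K"
    by (meson bounded_iff compact_imp_bounded imageI)
  have bound: "?h \<bar>u\<bar> \<le> max 1 K" for u
  proof (cases "\<bar>u\<bar> \<le> \<bar>U\<bar>")
    case True
    then have "?h \<bar>u\<bar> \<le> K" using K[of "\<bar>u\<bar>"] by (simp add: abs_le_iff)
    then show ?thesis by simp
  next
    case False
    then have "?h \<bar>u\<bar> < 1" by (intro U) linarith
    then show ?thesis by simp
  qed
  show ?thesis
  proof (rule Bochner_Integration.integrable_bound)
    show "integrable lborel (\<lambda>u::real. max 1 K * inverse (1 + u\<^sup>2))"
      using integrable_inverse_1_plus_square by (simp add: set_integrable_def)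
    show "AE u in lborel. norm ((\<bar>u\<bar> + b) ^ d * exp (- c * sqrt \<bar>u\<bar>)) \<le> norm (max 1 K * inverse (1 + u\<^sup>2))"
    proof (rule AE_I2)
      fix u :: real
      have "0 < 1 + u\<^sup>2" by (simp add: add_pos_nonneg)
      then have "(\<bar>u\<bar> + b) ^ d * exp (- c * sqrt \<bar>u\<bar>) \<le> max 1 K * inverse (1 + u\<^sup>2)"
        using bound[of u] by (simp add: field_simps)
      then show "norm ((\<bar>u\<bar> + b) ^ d * exp (- c * sqrt \<bar>u\<bar>)) \<le> norm (max 1 K * inverse (1 + u\<^sup>2))"
        using b by (simp add: abs_mult)
    qed
  qed auto
qed

lemma norm_cis_minus_linear: "norm (cis x - 1 - \<i> * x) \<le> x\<^sup>2 / 2"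
  using iexp_approx1[of x 1] by (simp add: cis_conv_exp fact_numeral power2_eq_square algebra_simps)

lemma norm_cis_minus_quadratic: "norm (cis x - 1 - \<i> * x + of_real (x\<^sup>2 / 2)) \<le> \<bar>x\<bar> ^ 3 / 6"
  using iexp_approx1[of x 2]
  by (simp add: cis_conv_exp fact_numeral power_mult_distrib eval_nat_numeral algebra_simps)

lemma inverse_lt_floor: "0 < A \<Longrightarrow> 1 / A < real (nat \<lfloor>1 / A\<rfloor>) + 1" for A :: real
proof -
  assume "0 < A"
  then have "real (nat \<lfloor>1 / A\<rfloor>) = of_int \<lfloor>1 / A\<rfloor>" by simp
  then show ?thesis by linarith
qed

lemma measurable_cis [measurable]: "cis \<in> borel_measurable borel"
  by (intro borel_measurable_continuous_onI continuous_intros)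

text \<open>
  The setting of the saddle point argument: the generating function of \<open>a\<close> is \<open>exp(G)\<close> with
  \<open>G(q) = \<Sum> c\<^sub>m q^m\<close>. Nonnegative \<open>c\<close> makes \<open>\<bar>exp(G)\<bar>\<close> maximal on the positive axis. The upper bounds
  on the moments say that the second and third derivatives of \<open>G(exp(-A))\<close> in \<open>A\<close> are at most of the
  order of those of \<open>1 / A\<close>. The weights on the progression of the
  numbers congruent to \<open>1\<close> modulo \<open>M\<close> supply the matching lower bounds and the decay away
  from the positive axis.
\<close>

locale exponential_gf =
  fixes a c :: "nat \<Rightarrow> real" and B C \<kappa> :: real and M :: nat
  assumes c_nonneg: "0 \<le> c m"
    and c_le: "c m \<le> B * real m"
    and gf: "norm q < 1 \<Longrightarrow> (\<lambda>n. complex_of_real (a n) * q ^ n) sums exp (\<Sum>m. complex_of_real (c m) * q ^ m)"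
    and second_moment: "0 < A \<Longrightarrow> A \<le> 1 \<Longrightarrow> (\<Sum>m. c m * real m ^ 2 * exp (- A * real m)) \<le> C / A ^ 3"
    and third_moment: "0 < A \<Longrightarrow> A \<le> 1 \<Longrightarrow> (\<Sum>m. c m * real m ^ 3 * exp (- A * real m)) \<le> C / A ^ 4"
    and M_pos: "1 \<le> M" and \<kappa>_pos: "0 < \<kappa>" and c_ge: "\<kappa> \<le> c (M * j + 1)"
begin

text \<open>
  Up to the sign \<open>(-1)^k\<close> this is the \<open>k\<close>-th derivative of \<open>A \<mapsto> G(exp(-A))\<close>: the first moment
  locates the saddle point, the second is the curvature of the limiting Gaussian there, and the third
  bounds the error of the Gaussian approximation.
\<close>

definition moment :: "nat \<Rightarrow> real \<Rightarrow> real" where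
  "moment k A = (\<Sum>m. c m * real m ^ k * exp (- A * real m))"

lemma summable_moment:
  assumes "A > 0"
  shows "summable (\<lambda>m. c m * real m ^ k * exp (- A * real m))"
proof (rule summable_comparison_test')
  show "summable (\<lambda>m. B * (real m ^ (k + 1) * exp (- A * real m)))"
    by (intro summable_mult summable_power_times_exp assms)
  show "norm (c m * real m ^ k * exp (- A * real m)) \<le> B * (real m ^ (k + 1) * exp (- A * real m))" for m
    using mult_right_mono[OF c_le[of m], of "real m ^ k * exp (- A * real m)"] c_nonneg[of m]
    by (simp add: abs_mult mult_ac)
qed

lemma moment_antimono:
  assumes "0 < A" "A \<le> A'"
  shows "moment k A' \<le> moment k A"
  unfolding moment_def
  by (intro suminf_le summable_moment mult_left_mono) (use assms c_nonneg in \<open>auto intro: mult_right_mono\<close>)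

lemma sum_progression_le:
  fixes g :: "nat \<Rightarrow> real"
  assumes "\<And>m. 0 \<le> g m" and "summable g"
  shows "(\<Sum>j\<le>J. g (M * j + 1)) \<le> suminf g"
proof -
  have "inj_on (\<lambda>j. M * j + 1) {..J}" using M_pos by (auto simp: inj_on_def)
  then have "(\<Sum>j\<le>J. g (M * j + 1)) = sum g ((\<lambda>j. M * j + 1) ` {..J})"
    by (simp add: sum.reindex)
  also have "\<dots> \<le> suminf g" by (rule sum_le_suminf) (use assms in auto)
  finally show ?thesis .
qed

lemma suminf_progression_le:
  fixes g :: "nat \<Rightarrow> real"
  assumes "\<And>m. 0 \<le> g m" and "summable g"
  shows "(\<Sum>j. g (M * j + 1)) \<le> suminf g"
proof -
  have *: "(\<Sum>j<n. g (M * j + 1)) \<le> suminf g" for n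
    using sum_progression_le[OF assms, of n] assms(1)[of "M * n + 1"]
    by (simp add: lessThan_Suc_atMost[symmetric])
  then have "summable (\<lambda>j. g (M * j + 1))"
    by (intro summableI_nonneg_bounded[where x = "suminf g"] assms)
  then show ?thesis using * by (rule suminf_le_const)
qed

text \<open>
  The cut-off \<open>j \<le> 1 / A\<close> is where the damping factor \<open>exp(-A m)\<close> is still bounded below, and
  the terms up to there already give the right order of magnitude.
\<close>

lemma progression_weight:
  assumes A: "0 < A" "A \<le> 1" and j: "j \<le> nat \<lfloor>1 / A\<rfloor>"
  shows "A * real (M * j + 1) \<le> real M + 1"
    and "\<kappa> * exp (- (real M + 1)) \<le> c (M * j + 1) * exp (- A * real (M * j + 1))"
proof -
  have "real j \<le> real (nat \<lfloor>1 / A\<rfloor>)" using j by simp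
  also have "\<dots> \<le> 1 / A" using A by (intro of_nat_floor) simp
  finally have "real j \<le> 1 / A" .
  then have "A * real j \<le> 1" using A by (simp add: field_simps)
  from mult_left_mono[OF this, of "real M"]
  show *: "A * real (M * j + 1) \<le> real M + 1" using A by (simp add: algebra_simps)
  show "\<kappa> * exp (- (real M + 1)) \<le> c (M * j + 1) * exp (- A * real (M * j + 1))"
    using * \<kappa>_pos c_ge[of j] c_nonneg[of "M * j + 1"] by (intro mult_mono) auto
qed

text \<open>
  A lower bound for \<open>c\<^sub>m exp(-A m)\<close> at the terms \<open>m = M j + 1\<close> of the progression with \<open>j \<le> 1 / A\<close>.
\<close>

definition \<kappa>' :: real where "\<kappa>' = \<kappa> * exp (- (real M + 1))"

lemma \<kappa>'_pos: "\<kappa>' > 0" using \<kappa>_pos by (simp add: \<kappa>'_def)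

lemma first_moment_ge:
  assumes A: "0 < A" "A \<le> 1"
  shows "\<kappa>' / A \<le> moment 1 A"
proof -
  let ?J = "nat \<lfloor>1 / A\<rfloor>"
  have "\<kappa>' / A \<le> \<kappa>' * (real ?J + 1)"
    using mult_left_mono[OF less_imp_le[OF inverse_lt_floor[OF A(1)]], of \<kappa>'] \<kappa>'_pos by simp
  also have "\<dots> = (\<Sum>j\<le>?J. \<kappa>')" by simp
  also have "\<dots> \<le> (\<Sum>j\<le>?J. c (M * j + 1) * real (M * j + 1) ^ 1 * exp (- A * real (M * j + 1)))"
  proof (rule sum_mono)
    fix j assume "j \<in> {..?J}"
    then have "\<kappa>' \<le> 1 * (c (M * j + 1) * exp (- A * real (M * j + 1)))"
      using progression_weight(2)[OF A, of j] by (simp add: \<kappa>'_def)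
    also have "\<dots> \<le> real (M * j + 1) * (c (M * j + 1) * exp (- A * real (M * j + 1)))"
      by (intro mult_right_mono mult_nonneg_nonneg c_nonneg) auto
    finally show "\<kappa>' \<le> c (M * j + 1) * real (M * j + 1) ^ 1 * exp (- A * real (M * j + 1))"
      by (simp add: mult_ac)
  qed
  also have "\<dots> \<le> moment 1 A"
    unfolding moment_def
    by (rule sum_progression_le[OF _ summable_moment[OF A(1)]]) (use c_nonneg in auto)
  finally show ?thesis .
qed

text \<open>
  Used twice: for the second moment, and for \<open>deficit\<close> below near \<open>\<theta> = 0\<close>, where \<open>1 - cos (m \<theta>)\<close> is
  of the order of \<open>m\<^sup>2 \<theta>\<^sup>2\<close>.
\<close>

lemma progression_square_sum:
  assumes A: "0 < A" "A \<le> 1"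
    and g: "\<And>m. 0 \<le> g m" "summable g"
    and h: "0 \<le> h" "\<And>j. j \<le> nat \<lfloor>1 / A\<rfloor> \<Longrightarrow> h * real (M * j + 1) ^ 2 \<le> g (M * j + 1)"
  shows "h / (3 * A ^ 3) \<le> suminf g"
proof -
  let ?J = "nat \<lfloor>1 / A\<rfloor>"
  have "1 / A \<le> real (?J + 1)" using inverse_lt_floor[OF A(1)] by linarith
  then have "(1 / A) ^ 3 \<le> real (?J + 1) ^ 3"
    by (rule power_mono) (use A in simp)
  then have "h * ((1 / A) ^ 3 / 3) \<le> h * (real (?J + 1) ^ 3 / 3)"
    by (intro mult_left_mono divide_right_mono h) auto
  also have "\<dots> \<le> h * (\<Sum>j\<le>?J. real (j + 1) ^ 2)"
    by (intro mult_left_mono sum_squares_ge h)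
  also have "\<dots> = (\<Sum>j\<le>?J. h * real (j + 1) ^ 2)"
    by (simp add: sum_distrib_left)
  also have "\<dots> \<le> (\<Sum>j\<le>?J. g (M * j + 1))"
  proof (rule sum_mono)
    fix j assume "j \<in> {..?J}"
    have "h * real (j + 1) ^ 2 \<le> h * real (M * j + 1) ^ 2"
      using M_pos by (intro mult_left_mono power_mono h) (auto simp flip: of_nat_mult)
    also have "\<dots> \<le> g (M * j + 1)" by (rule h) (use \<open>j \<in> _\<close> in auto)
    finally show "h * real (j + 1) ^ 2 \<le> g (M * j + 1)" .
  qed
  also have "\<dots> \<le> suminf g" by (rule sum_progression_le[OF g])
  finally show ?thesis by (simp add: power_divide mult_ac)
qed

lemma second_moment_ge:
  assumes A: "0 < A" "A \<le> 1"
  shows "\<kappa>' / (3 * A ^ 3) \<le> moment 2 A"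
  unfolding moment_def
proof (rule progression_square_sum[OF A])
  fix j assume "j \<le> nat \<lfloor>1 / A\<rfloor>"
  from mult_right_mono[OF progression_weight(2)[OF A this], of "real (M * j + 1) ^ 2"]
  show "\<kappa>' * real (M * j + 1) ^ 2 \<le> c (M * j + 1) * real (M * j + 1) ^ 2 * exp (- A * real (M * j + 1))"
    by (simp add: \<kappa>'_def mult_ac)
qed (use c_nonneg \<kappa>'_pos summable_moment A in auto)

lemma moment_2_pos: "0 < A \<Longrightarrow> A \<le> 1 \<Longrightarrow> moment 2 A > 0"
  using second_moment_ge[of A] \<kappa>'_pos by (smt (verit) divide_pos_pos zero_less_power)

lemma continuous_moment:
  assumes "A > 0"
  shows "isCont (moment k) A"
proof -
  have eq: "moment k = (\<lambda>A. \<Sum>m. (c m * real m ^ k) * exp (- A) ^ m)"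
    by (simp add: fun_eq_iff moment_def flip: exp_of_nat_mult) (simp add: mult.commute)
  have "summable (\<lambda>m. (c m * real m ^ k) * exp (- (A / 2)) ^ m)"
    using summable_moment[of "A / 2" k] assms by (simp add: mult.commute flip: exp_of_nat_mult)
  then have "isCont (\<lambda>x. (\<Sum>m. (c m * real m ^ k) * x ^ m)) (exp (- A))"
    by (rule isCont_powser) (use assms in auto)
  then show ?thesis unfolding eq
    by (intro isCont_o2[where f = "\<lambda>A. exp (- A)" and g = "\<lambda>x. \<Sum>m. (c m * real m ^ k) * x ^ m"] continuous_intros)
qed

text \<open>
  By the intermediate value theorem, since the first moment is continuous and unbounded as \<open>A\<close> tends to \<open>0\<close>.
\<close>

lemma saddle_point_exists:
  assumes n: "moment 1 1 \<le> real n"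
  shows "\<exists>A. 0 < A \<and> A \<le> 1 \<and> moment 1 A = real n"
proof -
  define l where "l = min 1 (\<kappa>' / (real n + 1))"
  have l: "0 < l" "l \<le> 1" using \<kappa>'_pos by (auto simp: l_def)
  have "real n \<le> \<kappa>' / (\<kappa>' / (real n + 1))" using \<kappa>'_pos by simp
  also have "\<dots> \<le> \<kappa>' / l" using \<kappa>'_pos l by (intro divide_left_mono) (auto simp: l_def)
  also have "\<dots> \<le> moment 1 l" by (rule first_moment_ge[OF l])
  finally have "\<exists>A\<ge>l. A \<le> 1 \<and> moment 1 A = real n"
    by (intro IVT2) (use n l in \<open>auto intro: continuous_moment\<close>)
  then show ?thesis using l by (meson less_le_trans)
qed

text \<open>
  With \<open>q = exp(-A)\<close> and \<open>G\<close> the exponent of the generating function,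
  \<open>log_ratio A \<theta> = G(q cis \<theta>) - G(q)\<close>, and \<open>deficit\<close> is minus its real part, a sum of nonnegative terms.
\<close>

definition deficit :: "real \<Rightarrow> real \<Rightarrow> real" where
  "deficit A \<theta> = (\<Sum>m. c m * exp (- A * real m) * (1 - cos (real m * \<theta>)))"

definition log_ratio :: "real \<Rightarrow> real \<Rightarrow> complex" where
  "log_ratio A \<theta> = (\<Sum>m. of_real (c m * exp (- A * real m)) * (cis (real m * \<theta>) - 1))"

lemma summable_log_ratio:
  assumes "A > 0"
  shows "summable (\<lambda>m. complex_of_real (c m * exp (- A * real m)) * (cis (real m * \<theta>) - 1))"
proof (rule summable_comparison_test')
  show "summable (\<lambda>m. 2 * (c m * real m ^ 0 * exp (- A * real m)))"
    by (intro summable_mult summable_moment assms)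
  fix m
  have "norm (cis (real m * \<theta>) - 1) \<le> 2"
    using norm_triangle_ineq4[of "cis (real m * \<theta>)" 1] by simp
  from mult_left_mono[OF this, of "c m * exp (- A * real m)"]
  show "norm (complex_of_real (c m * exp (- A * real m)) * (cis (real m * \<theta>) - 1)) \<le> 2 * (c m * real m ^ 0 * exp (- A * real m))"
    using c_nonneg[of m] by (simp add: norm_mult mult_ac)
qed

lemma summable_deficit:
  assumes "A > 0"
  shows "summable (\<lambda>m. c m * exp (- A * real m) * (1 - cos (real m * \<theta>)))"
  using summable_minus[OF summable_Re[OF summable_log_ratio[OF assms, of \<theta>]]]
  by (simp add: algebra_simps)

lemma Re_log_ratio:
  assumes "A > 0"
  shows "Re (log_ratio A \<theta>) = - deficit A \<theta>"
proof -
  have "Re (log_ratio A \<theta>) = (\<Sum>m. Re (complex_of_real (c m * exp (- A * real m)) * (cis (real m * \<theta>) - 1)))"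
    unfolding log_ratio_def by (rule Re_suminf[OF summable_log_ratio[OF assms]])
  also have "\<dots> = (\<Sum>m. - (c m * exp (- A * real m) * (1 - cos (real m * \<theta>))))"
    by (simp add: algebra_simps)
  also have "\<dots> = - deficit A \<theta>"
    unfolding deficit_def by (rule suminf_minus[OF summable_deficit[OF assms]])
  finally show ?thesis .
qed

lemma summable_gf_abs:
  assumes "A > 0"
  shows "summable (\<lambda>n. \<bar>a n\<bar> * exp (- A) ^ n)"
proof -
  have "summable (\<lambda>n. complex_of_real (a n) * (of_real (exp (- (A / 2)))) ^ n)"
    by (rule sums_summable[OF gf]) (use assms in auto)
  then have "summable (\<lambda>n. norm (complex_of_real (a n) * (of_real (exp (- A))) ^ n))"
    by (rule powser_insidea) (use assms in auto)
  then show ?thesis by (simp add: norm_mult norm_power)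
qed

lemma gf_on_circle:
  assumes A: "A > 0"
  shows "(\<Sum>n. of_real (a n) * (of_real (exp (- A)) * cis \<theta>) ^ n) = of_real (exp (moment 0 A)) * exp (log_ratio A \<theta>)"
proof -
  let ?q = "of_real (exp (- A)) * cis \<theta>"
  have pw: "?q ^ m = of_real (exp (- A * real m)) * cis (real m * \<theta>)" for m
    by (simp add: power_mult_distrib Complex.DeMoivre mult.commute[of A] flip: exp_of_nat_mult of_real_power)
  have "(\<Sum>n. of_real (a n) * ?q ^ n) = exp (\<Sum>m. of_real (c m) * ?q ^ m)"
    using gf[of ?q] A by (simp add: norm_mult sums_iff)
  also have "(\<Sum>m. of_real (c m) * ?q ^ m)
     = (\<Sum>m. of_real (c m * real m ^ 0 * exp (- A * real m)) + of_real (c m * exp (- A * real m)) * (cis (real m * \<theta>) - 1))"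
    unfolding pw by (intro suminf_cong) (simp add: algebra_simps)
  also have "\<dots> = of_real (moment 0 A) + log_ratio A \<theta>"
    unfolding moment_def log_ratio_def
    by (subst suminf_add[symmetric]) (use summable_log_ratio[OF A] summable_moment[OF A] in
         \<open>simp_all only: suminf_of_real summable_of_real\<close>)
  finally show ?thesis by (simp add: exp_add exp_of_real)
qed

text \<open>
  Taylor's formula term by term, the terms being dominated because \<open>c\<close> is nonnegative.
\<close>

lemma log_ratio_quadratic:
  assumes A: "A > 0"
  shows "norm (log_ratio A \<theta> - \<i> * of_real (moment 1 A * \<theta>) + of_real (moment 2 A * \<theta>\<^sup>2 / 2))
     \<le> \<bar>\<theta>\<bar> ^ 3 / 6 * moment 3 A"
proof -
  let ?w = "\<lambda>m. c m * exp (- A * real m)"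
  let ?t = "\<lambda>m. complex_of_real (?w m) * (cis (real m * \<theta>) - 1 - \<i> * of_real (real m * \<theta>) + of_real ((real m * \<theta>)\<^sup>2 / 2))"
  have 1: "(\<lambda>m. complex_of_real (?w m) * (cis (real m * \<theta>) - 1)) sums log_ratio A \<theta>"
    unfolding log_ratio_def using summable_log_ratio[OF A] by (rule summable_sums)
  have 2: "(\<lambda>m. \<i> * of_real \<theta> * complex_of_real (c m * real m ^ 1 * exp (- A * real m))) sums (\<i> * of_real \<theta> * of_real (moment 1 A))"
    unfolding moment_def by (intro sums_mult sums_of_real summable_sums summable_moment A)
  have 3: "(\<lambda>m. of_real (\<theta>\<^sup>2 / 2) * complex_of_real (c m * real m ^ 2 * exp (- A * real m))) sums (of_real (\<theta>\<^sup>2 / 2) * of_real (moment 2 A))"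
    unfolding moment_def by (intro sums_mult sums_of_real summable_sums summable_moment A)
  have "(\<lambda>m. complex_of_real (?w m) * (cis (real m * \<theta>) - 1) - \<i> * of_real \<theta> * complex_of_real (c m * real m ^ 1 * exp (- A * real m))
        + of_real (\<theta>\<^sup>2 / 2) * complex_of_real (c m * real m ^ 2 * exp (- A * real m)))
     sums (log_ratio A \<theta> - \<i> * of_real \<theta> * of_real (moment 1 A) + of_real (\<theta>\<^sup>2 / 2) * of_real (moment 2 A))"
    by (intro sums_add sums_diff 1 2 3)
  also have "(\<lambda>m. complex_of_real (?w m) * (cis (real m * \<theta>) - 1) - \<i> * of_real \<theta> * complex_of_real (c m * real m ^ 1 * exp (- A * real m))
        + of_real (\<theta>\<^sup>2 / 2) * complex_of_real (c m * real m ^ 2 * exp (- A * real m))) = ?t"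
    by (simp add: fun_eq_iff algebra_simps power_mult_distrib)
  also have "log_ratio A \<theta> - \<i> * of_real \<theta> * of_real (moment 1 A) + of_real (\<theta>\<^sup>2 / 2) * of_real (moment 2 A)
     = log_ratio A \<theta> - \<i> * of_real (moment 1 A * \<theta>) + of_real (moment 2 A * \<theta>\<^sup>2 / 2)"
    by (simp add: algebra_simps)
  finally have s: "?t sums \<dots>" .
  have "norm (?t m) \<le> \<bar>\<theta>\<bar> ^ 3 / 6 * (c m * real m ^ 3 * exp (- A * real m))" for m
  proof -
    have "norm (?t m) = ?w m * norm (cis (real m * \<theta>) - 1 - \<i> * of_real (real m * \<theta>) + of_real ((real m * \<theta>)\<^sup>2 / 2))"
      using c_nonneg[of m] by (simp only: norm_mult norm_of_real abs_mult abs_exp_cancel abs_of_nonneg)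
    also have "\<dots> \<le> ?w m * (\<bar>real m * \<theta>\<bar> ^ 3 / 6)"
      by (intro mult_left_mono norm_cis_minus_quadratic mult_nonneg_nonneg c_nonneg) auto
    finally show ?thesis by (simp add: abs_mult power_mult_distrib mult_ac)
  qed
  then have "norm (suminf ?t) \<le> (\<Sum>m. \<bar>\<theta>\<bar> ^ 3 / 6 * (c m * real m ^ 3 * exp (- A * real m)))"
    by (intro norm_suminf_le summable_mult summable_moment A)
  also have "\<dots> = \<bar>\<theta>\<bar> ^ 3 / 6 * moment 3 A"
    unfolding moment_def by (rule suminf_mult[OF summable_moment[OF A]])
  finally show ?thesis using sums_unique[OF s] by simp
qed

text \<open>
  In the scaled variable \<open>u = sqrt (moment 2 A) \<theta>\<close> the decay is uniform in \<open>A\<close>. For \<open>\<bar>\<theta>\<bar>\<close> below a multiple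
  of \<open>A\<close> it is Gaussian, of order \<open>\<theta>\<^sup>2 / A\<^sup>3\<close> and hence \<open>u\<^sup>2\<close>. Further out the deficit has order \<open>1 / A\<close>, while
  \<open>\<bar>u\<bar>\<close> is at most of order \<open>A powr (-3/2) \<le> 1 / A\<^sup>2\<close>. A multiple of
  \<open>sqrt \<bar>u\<bar> - 1\<close> is below both.
\<close>

lemma deficit_bound:
  "\<exists>\<gamma>>0. \<forall>A \<theta>. 0 < A \<longrightarrow> A \<le> 1 \<longrightarrow> \<bar>\<theta>\<bar> \<le> pi \<longrightarrow>
     \<gamma> * (sqrt \<bar>sqrt (moment 2 A) * \<theta>\<bar> - 1) \<le> deficit A \<theta>"
proof -
  define \<epsilon> where "\<epsilon> = 1 / (real M + 1)"
  have eps: "\<epsilon> > 0" by (simp add: \<epsilon>_def)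
  obtain \<delta> where \<delta>: "\<delta> > 0" and far: "\<And>A \<theta>. 0 < A \<Longrightarrow> A \<le> 1 \<Longrightarrow> \<epsilon> * A \<le> \<bar>\<theta>\<bar> \<Longrightarrow> \<bar>\<theta>\<bar> \<le> pi \<Longrightarrow>
     \<delta> / A \<le> (\<Sum>j. exp (- A * real (M * j + 1)) * (1 - cos (real (M * j + 1) * \<theta>)))"
    using far_arc_bound[OF eps M_pos] by blast
  have C_pos: "C > 0"
    using second_moment[of 1] moment_2_pos[of 1] by (simp add: moment_def)
  \<comment> \<open>\<open>K / A\<close> bounds \<open>v\<close> below: \<open>v ^ 4 \<le> pi\<^sup>2 C / A ^ 4\<close>, and \<open>K \<ge> 1\<close> gives \<open>pi\<^sup>2 C \<le> K ^ 4\<close>.\<close>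
  define K where "K = 1 + pi\<^sup>2 * C"
  have K: "K \<ge> 1" using C_pos by (simp add: K_def)
  define \<gamma> where "\<gamma> = min (\<kappa>' / (36 * C)) (\<kappa> * \<delta> / K)"
  have \<gamma>: "\<gamma> > 0" "\<gamma> \<le> \<kappa>' / (36 * C)" "\<gamma> \<le> \<kappa> * \<delta> / K"
    using \<kappa>'_pos \<kappa>_pos C_pos \<delta> K by (auto simp: \<gamma>_def)
  have "\<gamma> * (sqrt \<bar>sqrt (moment 2 A) * \<theta>\<bar> - 1) \<le> deficit A \<theta>"
    if A: "0 < A" "A \<le> 1" and th: "\<bar>\<theta>\<bar> \<le> pi" for A \<theta>
  proof -
    define v where "v = sqrt \<bar>sqrt (moment 2 A) * \<theta>\<bar>"
    have v0: "v \<ge> 0" by (simp add: v_def)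
    have "v ^ 4 = (v\<^sup>2)\<^sup>2" by simp
    also have "\<dots> = moment 2 A * \<theta>\<^sup>2"
      using moment_2_pos[OF A] by (simp add: v_def power_mult_distrib)
    finally have v4: "v ^ 4 = moment 2 A * \<theta>\<^sup>2" .
    have m2: "moment 2 A \<le> C / A ^ 3" using second_moment[OF A] by (simp add: moment_def)
    have nonneg: "0 \<le> c m * exp (- A * real m) * (1 - cos (real m * \<theta>))" for m
      using c_nonneg[of m] by simp
    show ?thesis
    proof (cases "\<bar>\<theta>\<bar> \<le> \<epsilon> * A")
      case True
      have "\<kappa>' * \<theta>\<^sup>2 / 12 / (3 * A ^ 3) \<le> deficit A \<theta>"
        unfolding deficit_def
      proof (rule progression_square_sum[OF A nonneg summable_deficit[OF A(1)]])
        show "0 \<le> \<kappa>' * \<theta>\<^sup>2 / 12" using \<kappa>'_pos by simp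
        fix j assume j: "j \<le> nat \<lfloor>1 / A\<rfloor>"
        have "\<bar>real (M * j + 1) * \<theta>\<bar> \<le> real (M * j + 1) * (\<epsilon> * A)"
          unfolding abs_mult using True by (intro mult_mono) auto
        also have "\<dots> \<le> 1"
          using progression_weight(1)[OF A j] by (simp add: \<epsilon>_def field_simps)
        finally have "\<bar>real (M * j + 1) * \<theta>\<bar> \<le> pi" using pi_gt3 by linarith
        from one_minus_cos_ge[OF this]
        have "\<kappa>' * ((real (M * j + 1) * \<theta>)\<^sup>2 / 12)
          \<le> c (M * j + 1) * exp (- A * real (M * j + 1)) * (1 - cos (real (M * j + 1) * \<theta>))"
          by (rule mult_mono[OF progression_weight(2)[OF A j, folded \<kappa>'_def]]) (use c_nonneg in auto)
        then show "\<kappa>' * \<theta>\<^sup>2 / 12 * real (M * j + 1) ^ 2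
          \<le> c (M * j + 1) * exp (- A * real (M * j + 1)) * (1 - cos (real (M * j + 1) * \<theta>))"
          by (simp add: power_mult_distrib mult_ac)
      qed
      moreover have "\<kappa>' * \<theta>\<^sup>2 / 12 / (3 * A ^ 3) = \<kappa>' / (36 * C) * (C / A ^ 3 * \<theta>\<^sup>2)"
        using C_pos by simp
      moreover have "\<kappa>' / (36 * C) * v ^ 4 \<le> \<kappa>' / (36 * C) * (C / A ^ 3 * \<theta>\<^sup>2)"
        unfolding v4 using m2 \<kappa>'_pos C_pos by (intro mult_left_mono mult_right_mono) auto
      moreover have "\<gamma> * (v - 1) \<le> \<gamma> * v ^ 4"
      proof (intro mult_left_mono)
        show "v - 1 \<le> v ^ 4"
        proof (cases "v \<le> 1")
          case False
          then have "v ^ 1 \<le> v ^ 4" by (intro power_increasing) auto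
          then show ?thesis by simp
        qed (use v0 zero_le_power[of v 4] in linarith)
      qed (use \<gamma> in auto)
      moreover have "\<gamma> * v ^ 4 \<le> \<kappa>' / (36 * C) * v ^ 4" using \<gamma>(2) by (intro mult_right_mono) auto
      ultimately show ?thesis by (simp add: v_def)
    next
      case False
      have "v ^ 4 \<le> C / A ^ 3 * pi\<^sup>2"
        unfolding v4 using m2 th C_pos A by (intro mult_mono) (auto simp: abs_le_square_iff[symmetric])
      also have "\<dots> \<le> C / A ^ 4 * pi\<^sup>2"
        using A C_pos power_decreasing[of 3 4 A] by (intro mult_right_mono divide_left_mono) auto
      also have "\<dots> \<le> K / A ^ 4" using A by (simp add: K_def field_simps)
      also have "\<dots> \<le> K ^ 4 / A ^ 4"
        using power_increasing[of 1 4 K] K A by (intro divide_right_mono) auto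
      finally have "v ^ 4 \<le> (K / A) ^ 4" by (simp add: power_divide)
      then have v: "v \<le> K / A" by (rule power_le_imp_le_base[where n = 3, simplified]) (use K A in auto)
      have "\<gamma> * (v - 1) \<le> \<gamma> * v" using \<gamma> by simp
      also have "\<dots> \<le> \<kappa> * \<delta> / K * v" using \<gamma> v0 by (intro mult_right_mono) auto
      also have "\<dots> \<le> \<kappa> * \<delta> / K * (K / A)" using v \<kappa>_pos \<delta> K by (intro mult_left_mono) auto
      also have "\<dots> = \<kappa> * (\<delta> / A)" using K by simp
      also have "\<dots> \<le> \<kappa> * (\<Sum>j. exp (- A * real (M * j + 1)) * (1 - cos (real (M * j + 1) * \<theta>)))"
        using far[OF A _ th] False \<kappa>_pos by (intro mult_left_mono) auto
      also have "\<dots> = (\<Sum>j. \<kappa> * (exp (- A * real (M * j + 1)) * (1 - cos (real (M * j + 1) * \<theta>))))"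
        by (rule suminf_mult[symmetric, OF sums_summable[OF geometric_progression_sum[OF A(1) M_pos]]])
      also have "\<dots> \<le> (\<Sum>j. c (M * j + 1) * exp (- A * real (M * j + 1)) * (1 - cos (real (M * j + 1) * \<theta>)))"
      proof (rule suminf_le)
        show "\<kappa> * (exp (- A * real (M * j + 1)) * (1 - cos (real (M * j + 1) * \<theta>)))
          \<le> c (M * j + 1) * exp (- A * real (M * j + 1)) * (1 - cos (real (M * j + 1) * \<theta>))" for j
          using mult_right_mono[OF c_ge[of j], of "exp (- A * real (M * j + 1)) * (1 - cos (real (M * j + 1) * \<theta>))"]
          by (simp add: mult.assoc)
        show "summable (\<lambda>j. \<kappa> * (exp (- A * real (M * j + 1)) * (1 - cos (real (M * j + 1) * \<theta>))))"
          by (rule summable_mult[OF sums_summable[OF geometric_progression_sum[OF A(1) M_pos]]])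
        have "inj (\<lambda>j. M * j + 1)" using M_pos by (auto simp: inj_on_def)
        from summable_reindex[OF summable_deficit[OF A(1), of \<theta>] this]
        show "summable (\<lambda>j. c (M * j + 1) * exp (- A * real (M * j + 1)) * (1 - cos (real (M * j + 1) * \<theta>)))"
          using nonneg by (simp add: o_def)
      qed
      also have "\<dots> \<le> deficit A \<theta>"
        unfolding deficit_def by (rule suminf_progression_le[OF nonneg summable_deficit[OF A(1)]])
      finally show ?thesis by (simp add: v_def)
    qed
  qed
  then show ?thesis using \<gamma>(1) by blast
qed

section \<open>Passage to the Hermite limit\<close>

definition width :: "real \<Rightarrow> real" where "width A = sqrt (moment 2 A)"

text \<open>
  The integrand of the scaled Fourier integral for the Jensen polynomial, divided by the value
  of the generating function at \<open>exp(-A)\<close>.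
\<close>

definition kernel :: "nat \<Rightarrow> real \<Rightarrow> nat \<Rightarrow> real \<Rightarrow> real \<Rightarrow> complex" where
  "kernel d X n A u = indicator {-(pi * width A)..pi * width A} u *\<^sub>R
     (exp (log_ratio A (u / width A)) * cis (- (real n * (u / width A)))
       * (of_real (width A) * (1 - cis (- (u / width A))) + of_real X * cis (- (u / width A))) ^ d)"

lemma width_pos: "0 < A \<Longrightarrow> A \<le> 1 \<Longrightarrow> 0 < width A"
  using moment_2_pos by (simp add: width_def)

lemma measurable_kernel [measurable]: "kernel d X n A \<in> borel_measurable lborel"
  unfolding kernel_def[abs_def] log_ratio_def by measurable

lemma kernel_integral:
  assumes A: "0 < A" "A \<le> 1"
  shows "(LBINT u. kernel d X n A u)
    = of_real ((2 * pi * exp (- A) ^ n * width A ^ Suc d / exp (moment 0 A))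
        * poly (jensen_poly a d n) (exp (- A) * (X / width A - 1)))"
proof -
  have "of_real (exp (moment 0 A)) * (LBINT u. kernel d X n A u) = (LBINT u. of_real (exp (moment 0 A)) * kernel d X n A u)"
    by (rule Bochner_Integration.integral_mult_right_zero[symmetric])
  also have "\<dots> = (LBINT u. indicator {-(pi * width A)..pi * width A} u *\<^sub>R
        ((\<Sum>k. of_real (a k) * (of_real (exp (- A)) * cis (u / width A)) ^ k) * cis (- (real n * (u / width A)))
         * (of_real (width A) * (1 - cis (- (u / width A))) + of_real X * cis (- (u / width A))) ^ d))"
    by (intro Bochner_Integration.integral_cong[OF refl])
       (simp only: gf_on_circle[OF A(1)] kernel_def mult.assoc mult_scaleR_right)
  also have "\<dots> = of_real (2 * pi * exp (- A) ^ n * width A ^ Suc d * poly (jensen_poly a d n) (exp (- A) * (X / width A - 1)))"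
    by (rule jensen_poly_scaled_integral) (use summable_gf_abs A width_pos in auto)
  finally show ?thesis by (simp add: field_simps)
qed

text \<open>
  The integrable majorant, independent of \<open>A\<close> and \<open>n\<close>. The cut-off of the kernel is what makes the decay
  estimate for \<open>\<bar>\<theta>\<bar> \<le> pi\<close> applicable.
\<close>

lemma norm_kernel_le:
  assumes A: "0 < A" "A \<le> 1"
    and decay: "\<And>\<theta>. \<bar>\<theta>\<bar> \<le> pi \<Longrightarrow> \<gamma> * (sqrt \<bar>sqrt (moment 2 A) * \<theta>\<bar> - 1) \<le> deficit A \<theta>"
  shows "norm (kernel d X n A u) \<le> exp \<gamma> * ((\<bar>u\<bar> + \<bar>X\<bar>) ^ d * exp (- \<gamma> * sqrt \<bar>u\<bar>))"
proof (cases "u \<in> {-(pi * width A)..pi * width A}")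
  case False
  then show ?thesis by (simp add: kernel_def)
next
  case True
  let ?\<theta> = "u / width A"
  have w: "width A > 0" using width_pos A by simp
  have th: "\<bar>?\<theta>\<bar> \<le> pi" using True w by (simp add: abs_le_iff field_simps)
  have "norm (exp (log_ratio A ?\<theta>)) = exp (- deficit A ?\<theta>)"
    using Re_log_ratio[OF A(1)] by (simp add: norm_exp_eq_Re)
  also have "\<dots> \<le> exp (- (\<gamma> * (sqrt \<bar>u\<bar> - 1)))"
    using decay[OF th] w by (simp add: width_def)
  also have "\<dots> = exp \<gamma> * exp (- \<gamma> * sqrt \<bar>u\<bar>)"
    by (simp add: algebra_simps flip: exp_add)
  finally have 1: "norm (exp (log_ratio A ?\<theta>)) \<le> exp \<gamma> * exp (- \<gamma> * sqrt \<bar>u\<bar>)" .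
  have "norm (1 - cis (- ?\<theta>)) \<le> \<bar>?\<theta>\<bar>"
    using iexp_approx1[of "- ?\<theta>" 0] by (simp add: cis_conv_exp norm_minus_commute)
  then have "width A * norm (1 - cis (- ?\<theta>)) \<le> width A * \<bar>?\<theta>\<bar>" using w by (intro mult_left_mono) auto
  then have "norm (of_real (width A) * (1 - cis (- ?\<theta>)) + of_real X * cis (- ?\<theta>)) \<le> \<bar>u\<bar> + \<bar>X\<bar>"
    using norm_triangle_ineq[of "of_real (width A) * (1 - cis (- ?\<theta>))" "of_real X * cis (- ?\<theta>)"] w
    by (simp add: norm_mult)
  then have 2: "norm ((of_real (width A) * (1 - cis (- ?\<theta>)) + of_real X * cis (- ?\<theta>)) ^ d) \<le> (\<bar>u\<bar> + \<bar>X\<bar>) ^ d"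
    unfolding norm_power by (intro power_mono) auto
  have "norm (kernel d X n A u) = norm (exp (log_ratio A ?\<theta>)) * norm ((of_real (width A) * (1 - cis (- ?\<theta>)) + of_real X * cis (- ?\<theta>)) ^ d)"
    using True by (simp add: kernel_def norm_mult)
  also have "\<dots> \<le> (exp \<gamma> * exp (- \<gamma> * sqrt \<bar>u\<bar>)) * (\<bar>u\<bar> + \<bar>X\<bar>) ^ d"
    by (intro mult_mono 1 2) auto
  finally show ?thesis by (simp add: mult_ac)
qed

text \<open>
  The minimum of \<open>A \<mapsto> G(exp(-A)) + n A\<close>. The value \<open>1\<close> for the finitely many small \<open>n\<close>
  keeps \<open>0 < saddle n \<le> 1\<close> for every \<open>n\<close>, so that all estimates hold along the whole sequence.
\<close>

definition saddle :: "nat \<Rightarrow> real" where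
  "saddle n = (if moment 1 1 \<le> real n then (SOME A. 0 < A \<and> A \<le> 1 \<and> moment 1 A = real n) else 1)"

lemma saddle: "moment 1 1 \<le> real n \<Longrightarrow> moment 1 (saddle n) = real n"
  and saddle_bounds: "0 < saddle n" "saddle n \<le> 1"
  using someI_ex[OF saddle_point_exists[of n]] by (auto simp: saddle_def)

lemma eventually_saddle: "\<forall>\<^sub>F n in sequentially. moment 1 (saddle n) = real n"
  using eventually_ge_at_top[of "nat \<lceil>moment 1 1\<rceil>"]
  by eventually_elim (rule saddle, linarith)

lemma saddle_tendsto_0: "saddle \<longlonglongrightarrow> 0"
proof (rule order_tendstoI)
  fix y :: real
  assume y: "y > 0"
  have "\<forall>\<^sub>F n in sequentially. real n > moment 1 y"
    using filterlim_real_sequentially by (simp add: filterlim_at_top_dense)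
  then show "\<forall>\<^sub>F n in sequentially. saddle n < y"
    using eventually_saddle
  proof eventually_elim
    case (elim n)
    then show ?case using moment_antimono[OF y, of "saddle n" 1] by linarith
  qed
qed (use saddle_bounds in \<open>auto intro: always_eventually less_trans\<close>)

lemma width_saddle_at_top: "filterlim (\<lambda>n. width (saddle n)) at_top sequentially"
proof -
  have "filterlim (\<lambda>n. \<kappa>' / 3 / saddle n ^ 3) at_top sequentially"
    by (rule LIM_at_top_divide[where a = "\<kappa>' / 3"])
       (use \<kappa>'_pos saddle_bounds in \<open>auto intro!: tendsto_eq_intros saddle_tendsto_0 always_eventually\<close>)
  then have "filterlim (\<lambda>n. moment 2 (saddle n)) at_top sequentially"
    by (rule filterlim_at_top_mono)
       (use second_moment_ge[OF saddle_bounds] in \<open>auto intro!: always_eventually simp: field_simps\<close>)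
  then show ?thesis unfolding width_def by (rule filterlim_compose[OF sqrt_at_top])
qed

text \<open>
  The square of the ratio is at most of order \<open>A^(-8) / A^(-9) = A\<close>.
\<close>

lemma skewness_tendsto_0: "(\<lambda>n. moment 3 (saddle n) / width (saddle n) ^ 3) \<longlonglongrightarrow> 0"
proof -
  let ?s = "\<lambda>n. moment 3 (saddle n) / width (saddle n) ^ 3"
  have m3: "0 \<le> moment 3 A" if "0 < A" for A
    unfolding moment_def by (intro suminf_nonneg summable_moment that) (use c_nonneg in auto)
  have "(\<lambda>n. (?s n)\<^sup>2) \<longlonglongrightarrow> 0"
  proof (rule tendsto_sandwich[where f = "\<lambda>_. 0"])
    show "(\<lambda>n. C\<^sup>2 * 27 / \<kappa>' ^ 3 * saddle n) \<longlonglongrightarrow> 0"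
      by (intro tendsto_mult_right_zero saddle_tendsto_0)
    have "(?s n)\<^sup>2 \<le> C\<^sup>2 * 27 / \<kappa>' ^ 3 * saddle n" for n
    proof -
      let ?A = "saddle n"
      have A: "0 < ?A" "?A \<le> 1" by (rule saddle_bounds)+
      have "(?s n)\<^sup>2 = (moment 3 ?A)\<^sup>2 / (moment 2 ?A) ^ 3"
      proof -
        have "(width ?A ^ 3)\<^sup>2 = ((width ?A)\<^sup>2) ^ 3" by (simp flip: power_mult)
        then show ?thesis using moment_2_pos[OF A] by (simp add: power_divide width_def)
      qed
      also have "\<dots> \<le> (C / ?A ^ 4)\<^sup>2 / (\<kappa>' / (3 * ?A ^ 3)) ^ 3"
        using third_moment[OF A] second_moment_ge[OF A] m3[OF A(1)] \<kappa>'_pos A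
        by (intro frac_le power_mono) (auto simp: moment_def)
      also have "\<dots> = C\<^sup>2 * 27 / \<kappa>' ^ 3 * ?A"
        using A by (simp add: power_divide power_mult_distrib field_simps flip: power_mult) (simp add: eval_nat_numeral)
      finally show ?thesis .
    qed
    then show "\<forall>\<^sub>F n in sequentially. (?s n)\<^sup>2 \<le> C\<^sup>2 * 27 / \<kappa>' ^ 3 * saddle n" by simp
  qed auto
  then have "(\<lambda>n. sqrt ((?s n)\<^sup>2)) \<longlonglongrightarrow> sqrt 0" by (rule tendsto_real_sqrt)
  then have "(\<lambda>n. \<bar>?s n\<bar>) \<longlonglongrightarrow> 0" by (simp only: real_sqrt_abs real_sqrt_zero)
  then show ?thesis by (simp only: tendsto_rabs_zero_iff)
qed

text \<open>
  The choice of the saddle point cancels the linear term of the Taylor expansion, the choice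
  of the width normalises the quadratic one, and the vanishing skewness removes the rest.
\<close>

lemma log_ratio_saddle_tendsto:
  "(\<lambda>n. log_ratio (saddle n) (u / width (saddle n)) - \<i> * of_real (real n * (u / width (saddle n))))
      \<longlonglongrightarrow> - of_real (u\<^sup>2 / 2)"
proof -
  let ?\<theta> = "\<lambda>n. u / width (saddle n)"
  have "(\<lambda>n. log_ratio (saddle n) (?\<theta> n) - \<i> * of_real (real n * ?\<theta> n) + of_real (u\<^sup>2 / 2)) \<longlonglongrightarrow> 0"
  proof (rule Lim_null_comparison)
    show "\<forall>\<^sub>F n in sequentially. norm (log_ratio (saddle n) (?\<theta> n) - \<i> * of_real (real n * ?\<theta> n) + of_real (u\<^sup>2 / 2))
        \<le> \<bar>u\<bar> ^ 3 / 6 * (moment 3 (saddle n) / width (saddle n) ^ 3)"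
      using eventually_saddle
    proof eventually_elim
      case (elim n)
      have w: "width (saddle n) > 0" by (intro width_pos saddle_bounds)
      have "moment 2 (saddle n) = (width (saddle n))\<^sup>2"
        using moment_2_pos[OF saddle_bounds, of n] by (simp add: width_def)
      then have "moment 2 (saddle n) * (?\<theta> n)\<^sup>2 = u\<^sup>2" using w by (simp add: power_divide)
      then show ?case
        using log_ratio_quadratic[OF saddle_bounds(1)[of n], of "?\<theta> n"] w
        by (simp only: elim abs_divide power_divide abs_of_pos) (simp add: mult_ac)
    qed
    show "(\<lambda>n. \<bar>u\<bar> ^ 3 / 6 * (moment 3 (saddle n) / width (saddle n) ^ 3)) \<longlonglongrightarrow> 0"
      using tendsto_mult_right_zero[OF skewness_tendsto_0] .
  qed
  from tendsto_diff[OF this tendsto_const[of "of_real (u\<^sup>2 / 2)"]]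
  show ?thesis by simp
qed

lemma kernel_tendsto: "(\<lambda>n. kernel d X n (saddle n) u) \<longlonglongrightarrow> gauss_pow X d u"
proof -
  let ?w = "\<lambda>n. width (saddle n)"
  let ?\<theta> = "\<lambda>n. u / ?w n"
  have w: "?w n > 0" for n by (intro width_pos saddle_bounds)
  have th0: "?\<theta> \<longlonglongrightarrow> 0"
    by (rule tendsto_divide_0[OF tendsto_const filterlim_at_top_imp_at_infinity[OF width_saddle_at_top]])
  have cis1: "(\<lambda>n. cis (- ?\<theta> n)) \<longlonglongrightarrow> 1"
    using tendsto_cis[OF tendsto_minus[OF th0]] by simp
  have lin: "(\<lambda>n. of_real (?w n) * (1 - cis (- ?\<theta> n))) \<longlonglongrightarrow> \<i> * of_real u"
  proof -
    have "(\<lambda>n. of_real (?w n) * (1 - cis (- ?\<theta> n)) - \<i> * of_real u) \<longlonglongrightarrow> 0"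
    proof (rule Lim_null_comparison)
      have "norm (of_real (?w n) * (1 - cis (- ?\<theta> n)) - \<i> * of_real u) \<le> \<bar>u\<bar> / 2 * \<bar>?\<theta> n\<bar>" for n
      proof -
        have "of_real (?w n) * (1 - cis (- ?\<theta> n)) - \<i> * of_real u
            = - of_real (?w n) * (cis (- ?\<theta> n) - 1 - \<i> * of_real (- ?\<theta> n))"
          using w[of n] by (simp add: algebra_simps)
        then have "norm (of_real (?w n) * (1 - cis (- ?\<theta> n)) - \<i> * of_real u)
            = ?w n * norm (cis (- ?\<theta> n) - 1 - \<i> * of_real (- ?\<theta> n))"
          using w[of n] by (simp add: norm_mult)
        also have "\<dots> \<le> ?w n * ((- ?\<theta> n)\<^sup>2 / 2)"
          using w[of n] by (intro mult_left_mono norm_cis_minus_linear) auto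
        also have "\<dots> = \<bar>u\<bar> / 2 * \<bar>?\<theta> n\<bar>"
          using w[of n] by (simp add: power2_eq_square abs_mult_self_eq flip: abs_mult)
        finally show ?thesis .
      qed
      then show "\<forall>\<^sub>F n in sequentially. norm (of_real (?w n) * (1 - cis (- ?\<theta> n)) - \<i> * of_real u) \<le> \<bar>u\<bar> / 2 * \<bar>?\<theta> n\<bar>"
        by simp
      show "(\<lambda>n. \<bar>u\<bar> / 2 * \<bar>?\<theta> n\<bar>) \<longlonglongrightarrow> 0"
        by (intro tendsto_mult_right_zero tendsto_rabs_zero th0)
    qed
    then show ?thesis by (simp add: LIM_zero_iff)
  qed
  have "(\<lambda>n. exp (log_ratio (saddle n) (?\<theta> n) - \<i> * of_real (real n * ?\<theta> n))
       * (of_real (?w n) * (1 - cis (- ?\<theta> n)) + of_real X * cis (- ?\<theta> n)) ^ d)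
     \<longlonglongrightarrow> exp (- of_real (u\<^sup>2 / 2)) * (\<i> * of_real u + of_real X * 1) ^ d"
    by (intro tendsto_intros log_ratio_saddle_tendsto lin cis1)
  also have "exp (- complex_of_real (u\<^sup>2 / 2)) * (\<i> * of_real u + of_real X * 1) ^ d = gauss_pow X d u"
    by (simp add: gauss_pow_def add.commute flip: exp_of_real)
  finally have lim: "(\<lambda>n. exp (log_ratio (saddle n) (?\<theta> n) - \<i> * of_real (real n * ?\<theta> n))
       * (of_real (?w n) * (1 - cis (- ?\<theta> n)) + of_real X * cis (- ?\<theta> n)) ^ d) \<longlonglongrightarrow> gauss_pow X d u" .
  have "\<forall>\<^sub>F n in sequentially. \<bar>u\<bar> \<le> ?w n"
    using width_saddle_at_top by (simp add: filterlim_at_top)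
  then have "\<forall>\<^sub>F n in sequentially. exp (log_ratio (saddle n) (?\<theta> n) - \<i> * of_real (real n * ?\<theta> n))
       * (of_real (?w n) * (1 - cis (- ?\<theta> n)) + of_real X * cis (- ?\<theta> n)) ^ d = kernel d X n (saddle n) u"
  proof eventually_elim
    case (elim n)
    have "?w n \<le> pi * ?w n" using w[of n] pi_gt3 by (simp add: mult_le_cancel_right1)
    then have "u \<in> {-(pi * ?w n)..pi * ?w n}" using elim by auto
    moreover have "exp (log_ratio (saddle n) (?\<theta> n) - \<i> * of_real (real n * ?\<theta> n))
       = exp (log_ratio (saddle n) (?\<theta> n)) * cis (- (real n * ?\<theta> n))"
      by (simp add: exp_diff cis_conv_exp exp_minus divide_inverse)
    ultimately show ?case unfolding kernel_def by simp
  qed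
  from Lim_transform_eventually[OF lim this] show ?thesis .
qed

lemma kernel_integral_tendsto:
  "(\<lambda>n. LBINT u. kernel d X n (saddle n) u) \<longlonglongrightarrow> (LBINT u. gauss_pow X d u)"
proof -
  obtain \<gamma> where \<gamma>: "\<gamma> > 0" and decay: "\<And>A \<theta>. 0 < A \<Longrightarrow> A \<le> 1 \<Longrightarrow> \<bar>\<theta>\<bar> \<le> pi \<Longrightarrow>
     \<gamma> * (sqrt \<bar>sqrt (moment 2 A) * \<theta>\<bar> - 1) \<le> deficit A \<theta>"
    using deficit_bound by blast
  show ?thesis
  proof (rule integral_dominated_convergence)
    show "integrable lborel (\<lambda>u. exp \<gamma> * ((\<bar>u\<bar> + \<bar>X\<bar>) ^ d * exp (- \<gamma> * sqrt \<bar>u\<bar>)))"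
      by (intro integrable_mult_right integrable_power_times_exp_sqrt \<gamma>) auto
    show "AE u in lborel. norm (kernel d X n (saddle n) u) \<le> exp \<gamma> * ((\<bar>u\<bar> + \<bar>X\<bar>) ^ d * exp (- \<gamma> * sqrt \<bar>u\<bar>))" for n
      by (rule AE_I2, rule norm_kernel_le[OF saddle_bounds decay[OF saddle_bounds]])
    show "AE u in lborel. (\<lambda>n. kernel d X n (saddle n) u) \<longlonglongrightarrow> gauss_pow X d u"
      using kernel_tendsto by simp
    show "gauss_pow X d \<in> borel_measurable lborel"
      by (rule borel_measurable_integrable[OF integrable_gauss_pow])
  qed (rule measurable_kernel)
qed

text \<open>
  The Jensen polynomial, evaluated at the affine image \<open>y n i\<close> of a point \<open>x i\<close> and multiplied by a
  positive factor, tends to a positive multiple of \<open>H\<^sub>d(x i)\<close>. The affine maps are increasing, so it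
  inherits the \<open>d + 1\<close> alternating signs of \<open>H\<^sub>d\<close>.
\<close>

theorem jensen_poly_eventually_hyperbolic:
  "\<exists>n0. \<forall>n\<ge>n0. hyperbolic (jensen_poly a d n)"
proof -
  obtain x :: "nat \<Rightarrow> real" where incr: "\<And>i j. i < j \<Longrightarrow> j \<le> d \<Longrightarrow> x i < x j"
    and sg: "\<And>i. i \<le> d \<Longrightarrow> (-1) ^ i * poly (hermite d) (x i) * (-1) ^ d > 0"
    using hermite_alternates[of d] by blast
  \<comment> \<open>The positive factor by which \<open>kernel_integral\<close> differs from the Jensen polynomial.\<close>
  define F where "F n = 2 * pi * exp (- saddle n) ^ n * width (saddle n) ^ Suc d / exp (moment 0 (saddle n))" for n
  define y where "y n i = exp (- saddle n) * (x i / width (saddle n) - 1)" for n i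
  have w: "width (saddle n) > 0" for n by (intro width_pos saddle_bounds)
  have F: "F n > 0" for n using w[of n] by (simp add: F_def)
  have "\<forall>\<^sub>F n in sequentially. \<forall>i\<le>d. (-1) ^ i * poly (jensen_poly a d n) (y n i) * (-1) ^ d > 0"
  proof (subst eventually_ball_finite_distrib[where A = "{..d}", unfolded Ball_def atMost_iff])
    show "\<forall>i\<le>d. \<forall>\<^sub>F n in sequentially. (-1) ^ i * poly (jensen_poly a d n) (y n i) * (-1) ^ d > 0"
    proof (intro allI impI)
      fix i assume i: "i \<le> d"
      have "(\<lambda>n. complex_of_real (F n * poly (jensen_poly a d n) (y n i)))
          \<longlonglongrightarrow> of_real (sqrt (2 * pi) * poly (hermite d) (x i))"
        using kernel_integral_tendsto[of d "x i"]
        by (simp only: kernel_integral[OF saddle_bounds] gauss_pow_integral F_def y_def)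
      then have "(\<lambda>n. F n * poly (jensen_poly a d n) (y n i)) \<longlonglongrightarrow> sqrt (2 * pi) * poly (hermite d) (x i)"
        by (simp only: tendsto_of_real_iff)
      then have lim: "(\<lambda>n. (-1) ^ i * (F n * poly (jensen_poly a d n) (y n i)) * (-1) ^ d)
          \<longlonglongrightarrow> (-1) ^ i * (sqrt (2 * pi) * poly (hermite d) (x i)) * (-1) ^ d"
        by (intro tendsto_mult[OF tendsto_mult[OF tendsto_const] tendsto_const])
      have "(-1) ^ i * (sqrt (2 * pi) * poly (hermite d) (x i)) * (-1) ^ d > 0"
        using mult_pos_pos[OF _ sg[OF i], of "sqrt (2 * pi)"] by (simp add: mult_ac)
      from order_tendstoD(1)[OF lim this]
      show "\<forall>\<^sub>F n in sequentially. (-1) ^ i * poly (jensen_poly a d n) (y n i) * (-1) ^ d > 0"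
      proof eventually_elim
        case (elim n)
        then have "0 < F n * ((-1) ^ i * poly (jensen_poly a d n) (y n i) * (-1) ^ d)"
          by (simp only: mult_ac)
        then show ?case using F[of n] by (rule zero_less_mult_pos)
      qed
    qed
  qed simp
  then obtain n0 where n0: "\<And>n i. n \<ge> n0 \<Longrightarrow> i \<le> d \<Longrightarrow> (-1) ^ i * poly (jensen_poly a d n) (y n i) * (-1) ^ d > 0"
    by (auto simp: eventually_sequentially)
  have "hyperbolic (jensen_poly a d n)" if "n \<ge> n0" for n
  proof (rule hyperbolic_if_sign_changes)
    show "degree (jensen_poly a d n) \<le> d"
      unfolding jensen_poly_def by (rule degree_sum_le) (auto intro: order_trans[OF degree_monom_le])
    show "y n i < y n j" if "i < j" "j \<le> d" for i j
      using incr[OF that] w[of n] by (simp add: y_def divide_strict_right_mono)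
    show "(-1) ^ i * poly (jensen_poly a d n) (y n i) * (-1) ^ d > 0" if "i \<le> d" for i
      using n0 \<open>n \<ge> n0\<close> that by blast
  qed
  then show ?thesis by blast
qed

end

section \<open>Generating function of overpartitions with restricted parts\<close>

text \<open>
  Positivity of the parts is expressed by \<open>0 \<notin> A\<close>.
\<close>

definition overpartitions_in :: "nat set \<Rightarrow> nat \<Rightarrow> (nat multiset \<times> nat set) set" where
  "overpartitions_in A N = {(P, L). set_mset P \<subseteq> A \<and> sum_mset P = N \<and> L \<subseteq> set_mset P}"

lemma finite_overpartitions_in: "0 \<notin> A \<Longrightarrow> finite (overpartitions_in A N)"
  by (rule finite_subset[OF _ finite_overpartitions[of N]])
     (auto simp: overpartitions_in_def overpartitions_def intro: Nat.gr0I)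

lemma overpartitions_in_empty: "overpartitions_in {} N = (if N = 0 then {({#}, {})} else {})"
  by (auto simp: overpartitions_in_def)

text \<open>
  An overpartition is split into its copies of \<open>a\<close>, of total size \<open>i\<close>, and the rest. If \<open>a\<close> occurs, the
  choice of overlining it or not gives the factor \<open>2\<close>.
\<close>

lemma card_overpartitions_in_insert:
  assumes a: "0 < a" "a \<notin> A" and A: "0 \<notin> A"
  shows "card (overpartitions_in (insert a A) N)
    = (\<Sum>i\<le>N. (if i = 0 then 1 else if a dvd i then 2 else 0) * card (overpartitions_in A (N - i)))"
proof -
  let ?T = "SIGMA i:{i \<in> {..N}. a dvd i}. (if i = 0 then {False} else UNIV) \<times> overpartitions_in A (N - i)"
  let ?f = "\<lambda>(P, L). (count P a * a, a \<in> L, filter_mset (\<lambda>x. x \<noteq> a) P, L - {a})"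
  let ?g = "\<lambda>(i, b, P, L). (P + replicate_mset (i div a) a, if b then insert a L else L)"
  have split: "P = filter_mset (\<lambda>x. x \<noteq> a) P + replicate_mset (count P a) a" for P
    by (simp add: multiset_eq_iff)
  have sum_split: "sum_mset P = sum_mset (filter_mset (\<lambda>x. x \<noteq> a) P) + count P a * a" for P
    by (subst split[of P]) (simp add: sum_mset_replicate_mset)
  have "bij_betw ?f (overpartitions_in (insert a A) N) ?T"
  proof (rule bij_betw_byWitness[where f' = ?g])
    show "\<forall>x\<in>overpartitions_in (insert a A) N. ?g (?f x) = x"
      using a by (auto simp: split[symmetric] split: if_splits)
    show "\<forall>y\<in>?T. ?f (?g y) = y"
    proof (clarify, goal_cases)
      case (1 i b P L)
      then have PL: "set_mset P \<subseteq> A" "L \<subseteq> set_mset P" by (auto simp: overpartitions_in_def)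
      then have "count P a = 0" "a \<notin> L" using a by (auto simp: count_eq_zero_iff)
      moreover have "filter_mset (\<lambda>x. x \<noteq> a) P = P"
        using PL a by (auto simp: filter_mset_eq_conv)
      ultimately show ?case using 1 by (auto split: if_splits)
    qed
    show "?f ` overpartitions_in (insert a A) N \<subseteq> ?T"
    proof (rule image_subsetI)
      fix x assume "x \<in> overpartitions_in (insert a A) N"
      then obtain P L where x: "x = (P, L)"
        and PL: "set_mset P \<subseteq> insert a A" "sum_mset P = N" "L \<subseteq> set_mset P"
        by (auto simp: overpartitions_in_def)
      have "a \<notin> L" if "count P a = 0"
        using PL that by (auto simp: count_eq_zero_iff)
      then show "?f x \<in> ?T"
        using PL sum_split[of P] a by (auto simp: x overpartitions_in_def)
    qed
    show "?g ` ?T \<subseteq> overpartitions_in (insert a A) N"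
      using a by (auto simp: overpartitions_in_def sum_mset_replicate_mset dvd_div_eq_0_iff dest: subsetD split: if_splits)
  qed
  then have "card (overpartitions_in (insert a A) N) = card ?T"
    by (rule bij_betw_same_card)
  also have "\<dots> = (\<Sum>i | i \<le> N \<and> a dvd i. card ((if i = 0 then {False} else UNIV) \<times> overpartitions_in A (N - i)))"
    by (subst card_SigmaI) (use finite_overpartitions_in[OF A] in auto)
  also have "\<dots> = (\<Sum>i | i \<le> N \<and> a dvd i. (if i = 0 then 1 else 2) * card (overpartitions_in A (N - i)))"
    by (intro sum.cong) (auto simp: card_cartesian_product)
  also have "\<dots> = (\<Sum>i\<le>N. (if i = 0 then 1 else if a dvd i then 2 else 0) * card (overpartitions_in A (N - i)))"
    by (intro sum.mono_neutral_cong_left) auto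
  finally show ?thesis .
qed

lemma sums_dilate:
  fixes f :: "nat \<Rightarrow> complex"
  assumes n: "0 < n" and s: "(\<lambda>k. f k * (q ^ n) ^ k) sums S"
  shows "(\<lambda>m. (if n dvd m then f (m div n) else 0) * q ^ m) sums S"
proof -
  have mono: "strict_mono (\<lambda>k. n * k)" using n by (simp add: strict_mono_def)
  have "(\<lambda>k. (if n dvd n * k then f (n * k div n) else 0) * q ^ (n * k)) sums S"
    using s n by (simp add: power_mult)
  then show ?thesis
    by (subst (asm) sums_mono_reindex[OF mono]) (auto elim: dvdE)
qed

lemma overlined_part_sums:
  fixes q :: complex
  assumes "0 < n" "norm q < 1"
  shows "(\<lambda>i. (if i = 0 then 1 else if n dvd i then 2 else 0) * q ^ i) sums ((1 + q ^ n) / (1 - q ^ n))"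
proof -
  let ?x = "q ^ n"
  have x: "norm ?x < 1" using assms by (simp add: norm_power power_less_one_iff)
  have "(\<lambda>k. 2 * ?x ^ k - (if k = 0 then 1 else 0)) sums (2 * (1 / (1 - ?x)) - 1)"
    by (intro sums_diff sums_mult geometric_sums x sums_single[of 0 "\<lambda>_. 1", simplified])
  moreover have "2 * (1 / (1 - ?x)) - 1 = (1 + ?x) / (1 - ?x)"
  proof -
    have "1 - ?x \<noteq> 0" using x by auto
    then show ?thesis by (simp add: field_simps)
  qed
  moreover have "2 * ?x ^ k - (if k = 0 then 1 else 0) = (if k = 0 then 1 else 2) * ?x ^ k" for k
    by simp
  ultimately have "(\<lambda>k. (if k = 0 then 1 else 2) * ?x ^ k) sums ((1 + ?x) / (1 - ?x))" by simp
  from sums_dilate[OF assms(1) this] show ?thesis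
    by (rule sums_cong[THEN iffD1, rotated]) (use assms(1) in \<open>auto elim!: dvdE\<close>)
qed

lemma overpartitions_in_gf:
  fixes q :: complex
  assumes "finite A" "0 \<notin> A" "norm q < 1"
  shows "(\<lambda>N. of_nat (card (overpartitions_in A N)) * q ^ N) sums (\<Prod>n\<in>A. (1 + q ^ n) / (1 - q ^ n))"
  using assms
proof (induction A arbitrary: q rule: finite_induct)
  case empty
  have "(\<lambda>N. of_nat (card (overpartitions_in {} N)) * q ^ N) = (\<lambda>N. if N = 0 then 1 else 0)"
    by (auto simp: overpartitions_in_empty)
  then show ?case using sums_single[of 0 "\<lambda>_. 1 :: complex"] by simp
next
  case (insert a A)
  let ?w = "\<lambda>i. (if i = 0 then 1 else if a dvd i then 2 else 0) :: complex"
  let ?p = "\<lambda>N. of_nat (card (overpartitions_in A N)) :: complex"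
  have a: "0 < a" using insert.prems by (auto intro: Nat.gr0I)
  obtain r where r: "norm q < r" "r < 1" using insert.prems dense by blast
  have r': "norm (complex_of_real r) < 1" "norm q < norm (complex_of_real r)"
    using r le_less_trans[OF norm_ge_zero r(1)] by auto
  have 1: "summable (\<lambda>i. norm (?w i * q ^ i))"
    by (rule powser_insidea[OF sums_summable[OF overlined_part_sums[OF a r'(1)]] r'(2)])
  have 2: "summable (\<lambda>N. norm (?p N * q ^ N))"
    by (rule powser_insidea[OF sums_summable[OF insert.IH[OF _ r'(1)]] r'(2)]) (use insert.prems in auto)
  have "(\<lambda>N. \<Sum>i\<le>N. (?w i * q ^ i) * (?p (N - i) * q ^ (N - i))) sums
     ((\<Sum>i. ?w i * q ^ i) * (\<Sum>N. ?p N * q ^ N))"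
    by (rule Cauchy_product_sums[OF 1 2])
  also have "(\<lambda>N. \<Sum>i\<le>N. (?w i * q ^ i) * (?p (N - i) * q ^ (N - i)))
     = (\<lambda>N. of_nat (card (overpartitions_in (insert a A) N)) * q ^ N)"
  proof
    fix N
    have "(\<Sum>i\<le>N. (?w i * q ^ i) * (?p (N - i) * q ^ (N - i))) = (\<Sum>i\<le>N. ?w i * ?p (N - i)) * q ^ N"
      unfolding sum_distrib_right by (intro sum.cong) (auto simp: mult_ac simp flip: power_add)
    also have "(\<Sum>i\<le>N. ?w i * ?p (N - i)) = of_nat (card (overpartitions_in (insert a A) N))"
      using insert.hyps insert.prems a
      by (subst card_overpartitions_in_insert) (auto simp: of_nat_sum intro!: sum.cong)
    finally show "(\<Sum>i\<le>N. (?w i * q ^ i) * (?p (N - i) * q ^ (N - i))) = of_nat (card (overpartitions_in (insert a A) N)) * q ^ N" .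
  qed
  also have "(\<Sum>i. ?w i * q ^ i) * (\<Sum>N. ?p N * q ^ N) = (\<Prod>n\<in>insert a A. (1 + q ^ n) / (1 - q ^ n))"
    using insert.hyps insert.prems
    by (simp add: sums_unique[OF overlined_part_sums[OF a], symmetric] sums_unique[OF insert.IH, symmetric])
  finally show ?case .
qed

text \<open>
  The coefficients of \<open>ln ((1 + q^n) / (1 - q^n))\<close> as a power series in \<open>q\<close>; only odd powers \<open>k\<close> of
  \<open>q^n\<close> occur, with coefficient \<open>2 / k\<close> for \<open>k = m / n\<close>.
\<close>

definition log_coeff :: "nat \<Rightarrow> nat \<Rightarrow> real" where
  "log_coeff n m = (if n dvd m \<and> odd (m div n) then 2 * real n / real m else 0)"

lemma log_coeff_nonneg: "0 \<le> log_coeff n m"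
  by (simp add: log_coeff_def)

lemma log_coeff_sums:
  fixes q :: complex
  assumes n: "0 < n" and q: "norm q < 1"
  shows "(\<lambda>m. of_real (log_coeff n m) * q ^ m) sums (ln (1 + q ^ n) - ln (1 - q ^ n))"
proof -
  let ?x = "q ^ n"
  let ?f = "\<lambda>k. if odd k then 2 / of_nat k else 0 :: complex"
  have x: "norm ?x < 1" "norm (- ?x) < 1" using assms by (auto simp: norm_power power_less_one_iff)
  have "(\<lambda>k. - ((- ?x) ^ k) / of_nat k - - ((- (- ?x)) ^ k) / of_nat k) sums (ln (1 + ?x) - ln (1 + - ?x))"
    by (intro sums_diff Ln_series' x)
  moreover have "- ((- ?x) ^ k) / of_nat k - - ((- (- ?x)) ^ k) / of_nat k = ?f k * ?x ^ k" for k
    by (cases "even k") auto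
  ultimately have "(\<lambda>k. ?f k * ?x ^ k) sums (ln (1 + ?x) - ln (1 - ?x))" by simp
  from sums_dilate[OF n this] show ?thesis
    by (rule sums_cong[THEN iffD1, rotated]) (use n in \<open>auto simp: log_coeff_def elim!: dvdE\<close>)
qed

lemma overpartitions_in_gf_exp:
  fixes q :: complex
  assumes "finite A" "0 \<notin> A" "norm q < 1"
  shows "(\<lambda>N. of_nat (card (overpartitions_in A N)) * q ^ N) sums
     exp (\<Sum>m. of_real (\<Sum>n\<in>A. log_coeff n m) * q ^ m)"
proof -
  have pos: "0 < n" if "n \<in> A" for n using that assms by (auto intro: Nat.gr0I)
  have "(\<lambda>m. \<Sum>n\<in>A. of_real (log_coeff n m) * q ^ m) sums (\<Sum>n\<in>A. ln (1 + q ^ n) - ln (1 - q ^ n))"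
    by (intro sums_sum log_coeff_sums pos assms)
  then have "(\<Sum>m. of_real (\<Sum>n\<in>A. log_coeff n m) * q ^ m) = (\<Sum>n\<in>A. ln (1 + q ^ n) - ln (1 - q ^ n))"
    by (simp add: sums_iff sum_distrib_right)
  also have "exp \<dots> = (\<Prod>n\<in>A. (1 + q ^ n) / (1 - q ^ n))"
    unfolding exp_sum[OF assms(1)]
  proof (rule prod.cong[OF refl])
    fix n assume "n \<in> A"
    then have "norm (q ^ n) < 1" using pos assms by (simp add: norm_power power_less_one_iff)
    then have "1 + q ^ n \<noteq> 0" "1 - q ^ n \<noteq> 0"
      by (auto simp: add_eq_0_iff)
    then show "exp (ln (1 + q ^ n) - ln (1 - q ^ n)) = (1 + q ^ n) / (1 - q ^ n)"
      by (simp add: exp_diff)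
  qed
  finally show ?thesis using overpartitions_in_gf[OF assms] by simp
qed

text \<open>
  For passing from finitely many admissible part sizes to infinitely many: each coefficient
  depends only on the part sizes up to its index, hence is eventually constant.
\<close>

lemma suminf_stationary_limit:
  fixes f :: "nat \<Rightarrow> nat \<Rightarrow> complex"
  assumes "\<And>m. \<forall>\<^sub>F K in sequentially. f m K = g m" and "\<And>m K. norm (f m K) \<le> h m" and "summable h"
  shows "(\<lambda>K. \<Sum>m. f m K) \<longlonglongrightarrow> (\<Sum>m. g m)"
  using tannerys_theorem[of f g sequentially h] assms
  by (auto intro: tendsto_eventually always_eventually)

definition parts_log_coeff :: "nat set \<Rightarrow> nat \<Rightarrow> real" where
  "parts_log_coeff G m = (\<Sum>n\<in>G \<inter> {1..m}. log_coeff n m)"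

lemma log_coeff_eq_0: "m < n \<Longrightarrow> log_coeff n m = 0"
  by (cases "m = 0") (auto simp: log_coeff_def dest: dvd_imp_le)

lemma sum_log_coeff_truncated:
  assumes "m \<le> K"
  shows "(\<Sum>n\<in>G \<inter> {1..K}. log_coeff n m) = parts_log_coeff G m"
  unfolding parts_log_coeff_def
  by (rule sum.mono_neutral_right) (use assms in \<open>auto intro!: log_coeff_eq_0\<close>)

lemma sum_log_coeff_le: "(\<Sum>n\<in>G \<inter> {1..K}. log_coeff n m) \<le> parts_log_coeff G m"
proof (cases "m \<le> K")
  case False
  then show ?thesis unfolding parts_log_coeff_def
    by (intro sum_mono2) (auto simp: log_coeff_nonneg)
qed (simp only: sum_log_coeff_truncated)

lemma parts_log_coeff_nonneg: "0 \<le> parts_log_coeff G m"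
  unfolding parts_log_coeff_def by (intro sum_nonneg log_coeff_nonneg)

lemma parts_log_coeff_le: "parts_log_coeff G m \<le> 2 * real m"
proof -
  have "log_coeff n m \<le> 2" if "n \<in> {1..m}" for n
    using that by (simp add: log_coeff_def field_simps)
  then have "parts_log_coeff G m \<le> real (card (G \<inter> {1..m})) * 2"
    unfolding parts_log_coeff_def by (intro sum_bounded_above) auto
  also have "card (G \<inter> {1..m}) \<le> card {1..m}" by (intro card_mono) auto
  finally show ?thesis by simp
qed

lemma summable_parts_log_coeff:
  assumes "0 \<le> r" "r < 1"
  shows "summable (\<lambda>m. parts_log_coeff G m * r ^ m)"
proof (cases "r = 0")
  case True
  have "(\<lambda>m. parts_log_coeff G m * r ^ m) = (\<lambda>m. if m = 0 then parts_log_coeff G m else 0)"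
    using True by auto
  then show ?thesis by simp
next
  case False
  have "summable (\<lambda>m. real m ^ 1 * exp (- (- ln r) * real m))"
    by (rule summable_power_times_exp) (use assms False in simp)
  then have "summable (\<lambda>m. 2 * (real m * r ^ m))"
    using assms False by (intro summable_mult) (simp add: mult.commute[of "ln r"] exp_of_nat_mult)
  then show ?thesis
    by (rule summable_comparison_test'[where N = 0])
       (use parts_log_coeff_le[of G] parts_log_coeff_nonneg[of G] assms in \<open>auto simp: mult.assoc[symmetric] intro!: mult_right_mono\<close>)
qed

lemma overpartitions_in_truncated:
  assumes "0 \<notin> G" "N \<le> K"
  shows "overpartitions_in (G \<inter> {1..K}) N = overpartitions_in G N"
proof -
  have "x \<in> {1..K}" if "x \<in># P" "set_mset P \<subseteq> G" "sum_mset P = N" for x P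
  proof -
    have "x \<le> sum_mset P" using that by (auto dest: multi_member_split)
    moreover have "x \<noteq> 0" using that assms by (metis subsetD)
    ultimately show ?thesis using that assms by auto
  qed
  then show ?thesis unfolding overpartitions_in_def by blast
qed

text \<open>
  Part sizes up to \<open>K\<close> give finite products, and then \<open>K\<close> tends to infinity on both sides. The bound
  \<open>exp (\<Sum> c\<^sub>m \<bar>q\<bar>^m)\<close>, uniform in \<open>K\<close>, yields the convergence of the counting series.
\<close>

lemma overpartitions_gf_exp:
  fixes q :: complex
  assumes G: "0 \<notin> G" and q: "norm q < 1"
  shows "(\<lambda>N. of_nat (card (overpartitions_in G N)) * q ^ N) sums
     exp (\<Sum>m. of_real (parts_log_coeff G m) * q ^ m)"
proof -
  let ?A = "\<lambda>K. G \<inter> {1..K}"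
  let ?p = "\<lambda>N. real (card (overpartitions_in G N))"
  let ?pK = "\<lambda>K N. real (card (overpartitions_in (?A K) N))"
  let ?cK = "\<lambda>K m. \<Sum>n\<in>?A K. log_coeff n m"
  let ?c = "parts_log_coeff G"
  let ?r = "norm q"
  have A: "finite (?A K)" "0 \<notin> ?A K" for K by auto
  have sm: "summable (\<lambda>m. ?c m * ?r ^ m)" by (intro summable_parts_log_coeff) (use q in auto)
  have term_le: "norm (of_real (?cK K m) * z ^ m) \<le> ?c m * norm z ^ m" for K m and z :: complex
  proof -
    have "\<bar>?cK K m\<bar> = ?cK K m" by (intro abs_of_nonneg sum_nonneg log_coeff_nonneg)
    then have "\<bar>?cK K m\<bar> \<le> ?c m" using sum_log_coeff_le[where G = G and K = K and m = m] by (rule ord_eq_le_trans)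
    then show ?thesis unfolding norm_mult norm_power norm_of_real by (rule mult_right_mono) simp
  qed
  have lim_exp: "(\<lambda>K. \<Sum>m. of_real (?cK K m) * q ^ m) \<longlonglongrightarrow> (\<Sum>m. of_real (?c m) * q ^ m)"
  proof (rule suminf_stationary_limit[OF _ term_le sm])
    show "\<forall>\<^sub>F K in sequentially. of_real (?cK K m) * q ^ m = of_real (?c m) * q ^ m" for m
      using eventually_ge_at_top[of m] by eventually_elim (simp only: sum_log_coeff_truncated)
  qed
  have p_le: "?pK K N \<le> ?p N" for K N
    by (intro of_nat_mono card_mono finite_overpartitions_in G) (auto simp: overpartitions_in_def)
  have sp: "summable (\<lambda>N. ?p N * ?r ^ N)"
  proof (rule summableI_nonneg_bounded)
    fix K
    have s: "(\<lambda>N. of_real (?pK K N * ?r ^ N)) sums exp (\<Sum>m. complex_of_real (?cK K m) * of_real ?r ^ m)"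
      using overpartitions_in_gf_exp[OF A, of "of_real ?r"] q by simp
    then have sr: "summable (\<lambda>N. ?pK K N * ?r ^ N)"
      using summable_Re[OF sums_summable[OF s]] by (simp only: Re_complex_of_real)
    have "(\<Sum>N<K. ?p N * ?r ^ N) = (\<Sum>N<K. ?pK K N * ?r ^ N)"
      by (intro sum.cong refl) (simp only: lessThan_iff overpartitions_in_truncated[OF G] less_imp_le)
    also have "\<dots> \<le> (\<Sum>N. ?pK K N * ?r ^ N)"
      by (rule sum_le_suminf[OF sr]) auto
    also have "\<dots> \<le> norm (complex_of_real (\<Sum>N. ?pK K N * ?r ^ N))" by simp
    also have "complex_of_real (\<Sum>N. ?pK K N * ?r ^ N) = exp (\<Sum>m. complex_of_real (?cK K m) * of_real ?r ^ m)"
      using sums_of_real[OF summable_sums[OF sr]] s by (rule sums_unique2)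
    also have "norm \<dots> \<le> exp (norm (\<Sum>m. complex_of_real (?cK K m) * of_real ?r ^ m))" by (rule norm_exp)
    also have "\<dots> \<le> exp (\<Sum>m. ?c m * ?r ^ m)"
    proof -
      have "norm (complex_of_real (?cK K m) * of_real ?r ^ m) \<le> ?c m * ?r ^ m" for m
        using term_le[of m K "of_real ?r"] by (simp only: norm_of_real abs_norm_cancel)
      from norm_suminf_le[OF this sm] show ?thesis by (simp only: exp_le_cancel_iff)
    qed
    finally show "(\<Sum>N<K. ?p N * ?r ^ N) \<le> exp (\<Sum>m. ?c m * ?r ^ m)" .
  qed auto
  have lim_p: "(\<lambda>K. \<Sum>N. of_real (?pK K N) * q ^ N) \<longlonglongrightarrow> (\<Sum>N. of_real (?p N) * q ^ N)"
  proof (rule suminf_stationary_limit[OF _ _ sp])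
    show "\<forall>\<^sub>F K in sequentially. of_real (?pK K N) * q ^ N = of_real (?p N) * q ^ N" for N
      using eventually_ge_at_top[of N] by eventually_elim (simp only: overpartitions_in_truncated[OF G])
    show "norm (of_real (?pK K N) * q ^ N) \<le> ?p N * ?r ^ N" for N K
      using p_le[of K N] by (auto simp: norm_mult norm_power intro!: mult_right_mono)
  qed
  have "(\<Sum>N. of_real (?pK K N) * q ^ N) = exp (\<Sum>m. of_real (?cK K m) * q ^ m)" for K
    using overpartitions_in_gf_exp[OF A q, of K] by (simp add: sums_iff)
  then have "(\<lambda>K. \<Sum>N. of_real (?pK K N) * q ^ N) \<longlonglongrightarrow> exp (\<Sum>m. of_real (?c m) * q ^ m)"
    using tendsto_exp[OF lim_exp] by simp
  from LIMSEQ_unique[OF lim_p this]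
  have "(\<Sum>N. of_real (?p N) * q ^ N) = exp (\<Sum>m. of_real (?c m) * q ^ m)" .
  moreover have "summable (\<lambda>N. of_real (?p N) * q ^ N)"
    by (rule summable_norm_cancel) (use sp in \<open>simp add: norm_mult norm_power\<close>)
  ultimately show ?thesis by (simp add: sums_iff)
qed

text \<open>
  Half of the exponential absorbs the power, by \<open>z^j / j! \<le> exp z\<close>; the other half is
  summed as a geometric series.
\<close>

lemma sum_power_times_exp_le:
  fixes y :: real
  assumes y: "y > 0"
  shows "(\<Sum>n=1..K. real n ^ j * exp (- y * real n)) \<le> fact j * (2 / y) ^ (j + 1)"
proof -
  define x where "x = exp (- (y / 2))"
  have x: "0 < x" "x < 1" using y by (auto simp: x_def)
  have pow_le: "z ^ j / fact j \<le> exp z" if "z \<ge> 0" for z :: real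
  proof -
    have "z ^ j / fact j = (\<Sum>i\<in>{j}. inverse (fact i) * z ^ i)" by (simp add: divide_inverse mult.commute)
    also have "\<dots> \<le> (\<Sum>i. inverse (fact i) * z ^ i)"
      using summable_exp[of z] that by (intro sum_le_suminf) auto
    finally show ?thesis by (simp add: exp_def scaleR_conv_of_real)
  qed
  have "real n ^ j * exp (- y * real n) \<le> fact j * (2 / y) ^ j * x ^ n" for n
  proof -
    have "(y / 2) ^ j * real n ^ j \<le> fact j * exp (real n * (y / 2))"
      using pow_le[of "real n * (y / 2)"] y by (simp add: power_mult_distrib field_simps)
    from mult_right_mono[OF this, of "(2 / y) ^ j * exp (- y * real n)"]
    have "((y / 2) * (2 / y)) ^ j * (real n ^ j * exp (- y * real n))
        \<le> fact j * (2 / y) ^ j * (exp (real n * (y / 2)) * exp (- y * real n))"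
      using y by (simp add: power_mult_distrib power_divide mult_ac)
    moreover have "exp (real n * (y / 2)) * exp (- y * real n) = x ^ n"
      by (simp add: x_def algebra_simps flip: exp_of_nat_mult exp_add)
    moreover have "(y / 2) * (2 / y) = 1" using y by simp
    ultimately show ?thesis by (simp only: power_one mult_1_left)
  qed
  then have "(\<Sum>n=1..K. real n ^ j * exp (- y * real n)) \<le> (\<Sum>n=1..K. fact j * (2 / y) ^ j * x ^ n)"
    by (rule sum_mono)
  also have "\<dots> = fact j * (2 / y) ^ j * (\<Sum>n=1..K. x ^ n)" by (simp add: sum_distrib_left)
  also have "(\<Sum>n=1..K. x ^ n) \<le> 2 / y"
  proof -
    have "(1 - x) * (\<Sum>n=1..K. x ^ n) = x - x ^ Suc K"
    proof (induction K)
      case (Suc K)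
      have "(1 - x) * (\<Sum>n=1..Suc K. x ^ n) = (1 - x) * (\<Sum>n=1..K. x ^ n) + (1 - x) * x ^ Suc K"
        by (simp add: distrib_left)
      then show ?case by (simp only: Suc.IH) (simp add: algebra_simps)
    qed auto
    then have "(1 - x) * (\<Sum>n=1..K. x ^ n) \<le> x" using x by simp
    moreover have "x * (1 + y / 2) \<le> 1"
    proof -
      have "x * (1 + y / 2) \<le> x * exp (y / 2)" using exp_ge_add_one_self[of "y / 2"] x by simp
      then show ?thesis by (simp add: x_def flip: exp_add)
    qed
    ultimately have "(y / 2) * ((1 - x) * (\<Sum>n=1..K. x ^ n)) \<le> 1 - x"
      using mult_left_mono[of "(1 - x) * (\<Sum>n=1..K. x ^ n)" x "y / 2"] y by (simp add: algebra_simps)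
    then have "(1 - x) * ((y / 2) * (\<Sum>n=1..K. x ^ n)) \<le> (1 - x) * 1" by (simp add: mult_ac)
    then have "(y / 2) * (\<Sum>n=1..K. x ^ n) \<le> 1" using x by (simp only: mult_le_cancel_left_pos diff_gt_0_iff_gt)
    then show ?thesis using y by (simp add: field_simps)
  qed
  finally show ?thesis using y by (simp add: mult_ac)
qed

lemma sum_inverse_squares_le: "(\<Sum>k=1..K. 1 / real k ^ 2) \<le> 2"
proof -
  have "(\<Sum>k=1..K. 1 / real k ^ 2) \<le> 2 - 1 / real K"
  proof (induction K)
    case (Suc K)
    have "1 / real (Suc K) ^ 2 \<le> 1 / real K - 1 / real (Suc K)" if "K > 0"
    proof -
      have "1 / real (Suc K) ^ 2 \<le> 1 / (real K * real (Suc K))"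
        using that by (intro divide_left_mono) (auto simp: power2_eq_square)
      also have "\<dots> = 1 / real K - 1 / real (Suc K)"
        using that by (simp add: field_simps)
      finally show ?thesis .
    qed
    then show ?case using Suc by (cases "K = 0") auto
  qed auto
  also have "\<dots> \<le> 2" by simp
  finally show ?thesis .
qed

text \<open>
  Enlarging the set of part sizes to all \<open>n\<close> and all cofactors \<open>k\<close>, the sum is at most
  \<open>\<Sum> (2 / k) (n k)^j exp(-A n k)\<close> over all \<open>n\<close> and \<open>k\<close>. The inner sum over \<open>n\<close> has order \<open>(A k)^(-j-1)\<close>, and the
  remaining \<open>\<Sum> 1 / k\<^sup>2\<close> converges, so that there is no logarithmic loss.
\<close>

lemma parts_log_coeff_moment_le:
  assumes A: "0 < A" and j: "1 \<le> j"
  shows "(\<Sum>m. parts_log_coeff G m * real m ^ j * exp (- A * real m)) \<le> 8 * fact j * 2 ^ j / A ^ (j + 1)"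
proof (rule suminf_le_const)
  let ?t = "\<lambda>m. parts_log_coeff G m * real m ^ j * exp (- A * real m)"
  show "summable ?t"
  proof (rule summable_comparison_test')
    show "summable (\<lambda>m. 2 * (real m ^ (j + 1) * exp (- A * real m)))"
      by (intro summable_mult summable_power_times_exp A)
    show "norm (?t m) \<le> 2 * (real m ^ (j + 1) * exp (- A * real m))" for m
      using mult_right_mono[OF parts_log_coeff_le[of G m], of "real m ^ j * exp (- A * real m)"] parts_log_coeff_nonneg[of G m]
      by (simp add: abs_mult mult_ac)
  qed
  fix K
  let ?F = "\<lambda>n m. 2 * real n / real m * (real m ^ j * exp (- A * real m))"
  have t_le: "?t m \<le> (\<Sum>n=1..K. if n dvd m then ?F n m else 0)" if "m \<in> {1..<K}" for m
  proof -
    have "parts_log_coeff G m = (\<Sum>n\<in>G \<inter> {1..K}. log_coeff n m)"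
      by (rule sum_log_coeff_truncated[symmetric]) (use that in simp)
    also have "\<dots> \<le> (\<Sum>n=1..K. log_coeff n m)"
      by (intro sum_mono2) (auto simp: log_coeff_nonneg)
    also have "\<dots> \<le> (\<Sum>n=1..K. if n dvd m then 2 * real n / real m else 0)"
      by (intro sum_mono) (auto simp: log_coeff_def)
    finally have "parts_log_coeff G m * (real m ^ j * exp (- A * real m)) \<le> (\<Sum>n=1..K. if n dvd m then 2 * real n / real m else 0) * (real m ^ j * exp (- A * real m))"
      by (rule mult_right_mono) auto
    also have "\<dots> = (\<Sum>n=1..K. if n dvd m then ?F n m else 0)"
      unfolding sum_distrib_right by (intro sum.cong) auto
    finally show ?thesis by (simp add: mult_ac)
  qed
  have "(\<Sum>m<K. ?t m) = (\<Sum>m\<in>{1..<K}. ?t m)"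
    by (rule sum.mono_neutral_right) (use j in auto)
  also have "\<dots> \<le> (\<Sum>m\<in>{1..<K}. \<Sum>n=1..K. if n dvd m then ?F n m else 0)"
    by (rule sum_mono[OF t_le])
  also have "\<dots> = (\<Sum>n=1..K. \<Sum>m\<in>{1..<K}. if n dvd m then ?F n m else 0)"
    by (rule sum.swap)
  also have "\<dots> \<le> (\<Sum>n=1..K. \<Sum>k=1..K. ?F n (n * k))"
  proof (rule sum_mono)
    fix n assume n: "n \<in> {1..K}"
    have "(\<Sum>m\<in>{1..<K}. if n dvd m then ?F n m else 0) = (\<Sum>m | m \<in> {1..<K} \<and> n dvd m. ?F n m)"
      by (rule sum.inter_filter[symmetric]) simp
    also have "\<dots> \<le> (\<Sum>m\<in>(\<lambda>k. n * k) ` {1..K}. ?F n m)"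
    proof (rule sum_mono2)
      show "{m. m \<in> {1..<K} \<and> n dvd m} \<subseteq> (\<lambda>k. n * k) ` {1..K}"
      proof clarify
        fix m assume m: "m \<in> {1..<K}" "n dvd m"
        then obtain k where k: "m = n * k" by (auto elim: dvdE)
        then have "k \<noteq> 0" "k \<le> m" using m n by auto
        moreover have "m \<le> K" using m by simp
        ultimately have "k \<in> {1..K}" by simp
        then show "m \<in> (\<lambda>k. n * k) ` {1..K}" using k by blast
      qed
    qed auto
    also have "\<dots> = (\<Sum>k=1..K. ?F n (n * k))"
      using n by (subst sum.reindex) (auto simp: inj_on_def)
    finally show "(\<Sum>m\<in>{1..<K}. if n dvd m then ?F n m else 0) \<le> (\<Sum>k=1..K. ?F n (n * k))" .
  qed
  also have "\<dots> = (\<Sum>k=1..K. \<Sum>n=1..K. ?F n (n * k))"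
    by (rule sum.swap)
  also have "\<dots> \<le> (\<Sum>k=1..K. 4 * fact j * 2 ^ j / A ^ (j + 1) * (1 / real k ^ 2))"
  proof (rule sum_mono)
    fix k assume k: "k \<in> {1..K}"
    have "(\<Sum>n=1..K. ?F n (n * k)) = (\<Sum>n=1..K. 2 * real k ^ j / real k * (real n ^ j * exp (- (A * real k) * real n)))"
      by (intro sum.cong) (auto simp: power_mult_distrib mult_ac)
    also have "\<dots> = 2 * real k ^ j / real k * (\<Sum>n=1..K. real n ^ j * exp (- (A * real k) * real n))"
      by (simp add: sum_distrib_left)
    also have "\<dots> \<le> 2 * real k ^ j / real k * (fact j * (2 / (A * real k)) ^ (j + 1))"
      by (intro mult_left_mono sum_power_times_exp_le) (use A k in auto)
    also have "\<dots> = 4 * fact j * 2 ^ j / A ^ (j + 1) * (1 / real k ^ 2)"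
      using A k by (simp add: power_divide power_mult_distrib field_simps power2_eq_square)
    finally show "(\<Sum>n=1..K. ?F n (n * k)) \<le> 4 * fact j * 2 ^ j / A ^ (j + 1) * (1 / real k ^ 2)" .
  qed
  also have "\<dots> = 4 * fact j * 2 ^ j / A ^ (j + 1) * (\<Sum>k=1..K. 1 / real k ^ 2)"
    by (simp add: sum_distrib_left)
  also have "\<dots> \<le> 4 * fact j * 2 ^ j / A ^ (j + 1) * 2"
    by (intro mult_left_mono sum_inverse_squares_le) (use A in auto)
  finally show "(\<Sum>m<K. ?t m) \<le> 8 * fact j * 2 ^ j / A ^ (j + 1)" by simp
qed

text \<open>
  The constant \<open>384 = 8 * 3! * 2^3\<close> is the moment bound for \<open>j = 3\<close>, which also covers \<open>j = 2\<close>.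
\<close>

lemma parts_exponential_gf:
  fixes G :: "nat set"
  assumes G: "0 \<notin> G" and M: "1 \<le> M" and prog: "\<And>j. M * j + 1 \<in> G"
  shows "exponential_gf (\<lambda>N. real (card (overpartitions_in G N))) (parts_log_coeff G) 2 384 2 M"
proof
  fix A :: real and m j :: nat and q :: complex
  show "0 \<le> parts_log_coeff G m" by (rule parts_log_coeff_nonneg)
  show "parts_log_coeff G m \<le> 2 * real m" by (rule parts_log_coeff_le)
  show "(\<lambda>n. complex_of_real (real (card (overpartitions_in G n))) * q ^ n) sums
      exp (\<Sum>m. complex_of_real (parts_log_coeff G m) * q ^ m)" if "norm q < 1"
    using overpartitions_gf_exp[OF G that] by simp
  assume A: "0 < A" "A \<le> 1"
  show "(\<Sum>m. parts_log_coeff G m * real m ^ 2 * exp (- A * real m)) \<le> 384 / A ^ 3"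
  proof -
    have "(\<Sum>m. parts_log_coeff G m * real m ^ 2 * exp (- A * real m)) \<le> 64 / A ^ 3"
      using parts_log_coeff_moment_le[OF A(1), of 2 G] by (simp add: fact_numeral)
    also have "\<dots> \<le> 384 / A ^ 3" using A by (intro divide_right_mono) auto
    finally show ?thesis .
  qed
  show "(\<Sum>m. parts_log_coeff G m * real m ^ 3 * exp (- A * real m)) \<le> 384 / A ^ 4"
    using parts_log_coeff_moment_le[OF A(1), of 3 G] by (simp add: fact_numeral)
next
  fix j
  let ?m = "M * j + 1"
  have "log_coeff n n = 2" if "0 < n" for n
    using that by (simp add: log_coeff_def)
  from this[of ?m] have "2 = log_coeff ?m ?m" by simp
  also have "\<dots> \<le> parts_log_coeff G ?m"
    unfolding parts_log_coeff_def using prog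
    by (intro member_le_sum) (auto simp: log_coeff_nonneg)
  finally show "2 \<le> parts_log_coeff G ?m" .
qed (use M in auto)

section \<open>Biregular overpartitions\<close>

theorem theorem1p7:
  fixes s t d :: nat
  assumes "t < s" and "10 \<le> t" and "coprime s t" and "1 \<le> d"
  shows "\<exists>N0::nat. \<forall>N\<ge>N0. hyperbolic (jensen_poly (\<lambda>n. real (pbar s t n)) d N)"
proof -
  define G where "G = {n. \<not> s dvd n \<and> \<not> t dvd n}"
  have "biregular_overpartitions s t N = overpartitions_in G N" for N
    unfolding biregular_overpartitions_def overpartitions_def overpartitions_in_def G_def
    by (auto intro: Nat.gr0I)
  then have pbar: "pbar s t N = card (overpartitions_in G N)" for N
    by (simp add: pbar_def)
  \<comment> \<open>All numbers congruent to 1 modulo \<open>s * t\<close> are admissible part sizes.\<close>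
  have "\<not> x dvd x * y + 1" if "10 \<le> x" for x y :: nat
    using that by (subst dvd_add_right_iff) auto
  from this[of s "t * _"] this[of t "s * _"]
  have "s * t * j + 1 \<in> G" for j
    using assms by (simp add: G_def mult_ac)
  moreover have "0 \<notin> G" "1 \<le> s * t" using assms by (auto simp: G_def)
  ultimately have "exponential_gf (\<lambda>N. real (card (overpartitions_in G N))) (parts_log_coeff G) 2 384 2 (s * t)"
    by (intro parts_exponential_gf) auto
  then show ?thesis
    unfolding pbar by (rule exponential_gf.jensen_poly_eventually_hyperbolic)
qed

end
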